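(* Let $n\ge1$. There is a constant $C>0$ depending only on $n$ such that the following holds. Let $u_0\in H^1({\bf R}^n)\cap L^1({\bf R}^n)$ and $u_1\in L^2({\bf R}^n)\cap L^{1,1}({\bf R}^n)$, and let $u(t,x)$ be the solution (case $\mu=2$) of $$u_{tt}-\Delta u+2 L u_t=0\ \text{ in }(0,\infty)\times{\bf R}^n,\qquad u(0,x)=u_0(x),\quad u_t(0,x)=u_1(x),\ x\in{\bf R}^n.$$ Then $$\big\Vert u(t,\cdot)-{\cal F}^{-1}_{\xi\to x}\big(\nu(t,\xi)\big)(\cdot)\big\Vert\le C\big(\Vert u_1\Vert_{1,1}+\Vert u_0\Vert_1\big)\,t^{-\frac n2}$$ for all sufficiently large $t$, where, with $r=|\xi|$, $$\nu(t,\xi):=(1+r)^{-t}\,\frac{1}{\sqrt{r^2-\log^2(1+r)}}\,\sin\left(t\sqrt{r^2-\log^2(1+r)}\right)P_1,\qquad P_1:=\int_{{\bf R}^n}u_1(x)\,dx.$$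
   Context: Fourier transform: ${\cal F}_{x\to\xi}(f)(\xi)=\hat f(\xi)=\int_{{\bf R}^n}e^{-ix\cdot\xi}f(x)\,dx$, with inverse ${\cal F}^{-1}_{\xi\to x}$. The operator $L=\log(I+(-\Delta)^{1/2})$ on $L^2({\bf R}^n)$ is the Fourier multiplier $(Lf)(x)={\cal F}^{-1}_{\xi\to x}(\log(1+|\xi|)\hat f(\xi))(x)$ with domain $D(L)=\{f\in L^2:\int(1+\log^2(1+|\xi|))|\hat f(\xi)|^2d\xi<\infty\}$. For $(u_0,u_1)\in H^1({\bf R}^n)\times L^2({\bf R}^n)$ "the solution" is the unique mild solution $u\in C([0,\infty);H^1({\bf R}^n))\cap C^1([0,\infty);L^2({\bf R}^n))$; equivalently, $w(t,\xi)=\hat u(t,\xi)$ (Fourier transform in $x$) solves $w_{tt}+2\log(1+|\xi|)w_t+|\xi|^2w=0$, $w(0,\xi)=\hat u_0(\xi)$, $w_t(0,\xi)=\hat u_1(\xi)$. Norms: $\Vert\cdot\Vert_q$ is the $L^q({\bf R}^n)$-norm, $\Vert\cdot\Vert=\Vert\cdot\Vert_2$, and $L^{1,1}({\bf R}^n)=\{f\in L^1:\Vert f\Vert_{1,1}:=\int_{{\bf R}^n}(1+|x|)|f(x)|dx<\infty\}$. The function $\nu(t,\cdot)$ is defined for $\xi\ne0$ (almost everywhere). *)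

theory Defs
  imports "HOL-Analysis.Analysis"
begin

text \<open>
  Functions on the n-dimensional Euclidean space are complex-valued functions on
  \<open>real ^ 'n\<close>, with n = \<open>CARD('n)\<close>, and measurability and integration refer to Lebesgue measure.
  The norms below are real-valued and are meaningful only together with the corresponding
  membership in the space (a non-integrable Bochner integral is 0).
\<close>

definition in_L2 :: "(real ^ 'n \<Rightarrow> complex) \<Rightarrow> bool" where
  "in_L2 f \<longleftrightarrow> f \<in> borel_measurable lebesgue \<and> integrable lebesgue (\<lambda>x. (norm (f x))\<^sup>2)"

definition L2_norm :: "(real ^ 'n \<Rightarrow> complex) \<Rightarrow> real" where
  "L2_norm f = sqrt (LINT x|lebesgue. (norm (f x))\<^sup>2)"

definition in_L1 :: "(real ^ 'n \<Rightarrow> complex) \<Rightarrow> bool" where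
  "in_L1 f \<longleftrightarrow> integrable lebesgue f"

definition L1_norm :: "(real ^ 'n \<Rightarrow> complex) \<Rightarrow> real" where
  "L1_norm f = (LINT x|lebesgue. norm (f x))"

definition in_L11 :: "(real ^ 'n \<Rightarrow> complex) \<Rightarrow> bool" where
  "in_L11 f \<longleftrightarrow> in_L1 f \<and> integrable lebesgue (\<lambda>x. (1 + norm x) * norm (f x))"

definition L11_norm :: "(real ^ 'n \<Rightarrow> complex) \<Rightarrow> real" where
  "L11_norm f = (LINT x|lebesgue. (1 + norm x) * norm (f x))"

definition fourier :: "(real ^ 'n \<Rightarrow> complex) \<Rightarrow> real ^ 'n \<Rightarrow> complex" where
  "fourier f \<xi> = (LINT x|lebesgue. exp (- (\<i> * of_real (x \<bullet> \<xi>))) * f x)"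

definition inv_fourier :: "(real ^ 'n \<Rightarrow> complex) \<Rightarrow> real ^ 'n \<Rightarrow> complex" where
  "inv_fourier g x =
     of_real (1 / (2 * pi) ^ CARD('n)) * (LINT \<xi>|lebesgue. exp (\<i> * of_real (x \<bullet> \<xi>)) * g \<xi>)"

text \<open>
  The Fourier transform of a square-integrable function f is the limit in mean, as R tends to
  infinity, of the Fourier integrals of f over the balls of radius R. By Plancherel's theorem this
  limit exists; it is determined only up to a null set, and \<open>SOME\<close> picks a representative.
\<close>

definition L2_fourier :: "(real ^ 'n \<Rightarrow> complex) \<Rightarrow> real ^ 'n \<Rightarrow> complex" where
  "L2_fourier f = (SOME g. in_L2 g \<and>
     ((\<lambda>R. L2_norm (\<lambda>\<xi>. fourier (\<lambda>x. indicat_real (ball 0 R) x *\<^sub>R f x) \<xi> - g \<xi>)) \<longlongrightarrow> 0) at_top)"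

definition in_H1 :: "(real ^ 'n \<Rightarrow> complex) \<Rightarrow> bool" where
  "in_H1 f \<longleftrightarrow> in_L2 f \<and> integrable lebesgue (\<lambda>\<xi>. (1 + (norm \<xi>)\<^sup>2) * (norm (L2_fourier f \<xi>))\<^sup>2)"

definition H1_norm :: "(real ^ 'n \<Rightarrow> complex) \<Rightarrow> real" where
  "H1_norm f = sqrt (LINT \<xi>|lebesgue. (1 + (norm \<xi>)\<^sup>2) * (norm (L2_fourier f \<xi>))\<^sup>2)"

text \<open>
  Curves are indexed by all real times; only the times \<open>t \<ge> 0\<close> matter, and continuity and
  differentiability at 0 are one-sided.
\<close>

definition continuous_H1 :: "(real \<Rightarrow> real ^ 'n \<Rightarrow> complex) \<Rightarrow> bool" where
  "continuous_H1 u \<longleftrightarrow> (\<forall>t\<ge>0. in_H1 (u t) \<and>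
     ((\<lambda>s. H1_norm (\<lambda>x. u s x - u t x)) \<longlongrightarrow> 0) (at t within {0..}))"

definition continuous_L2 :: "(real \<Rightarrow> real ^ 'n \<Rightarrow> complex) \<Rightarrow> bool" where
  "continuous_L2 u \<longleftrightarrow> (\<forall>t\<ge>0. in_L2 (u t) \<and>
     ((\<lambda>s. L2_norm (\<lambda>x. u s x - u t x)) \<longlongrightarrow> 0) (at t within {0..}))"

definition has_L2_derivative ::
    "(real \<Rightarrow> real ^ 'n \<Rightarrow> complex) \<Rightarrow> (real \<Rightarrow> real ^ 'n \<Rightarrow> complex) \<Rightarrow> bool" where
  "has_L2_derivative u v \<longleftrightarrow> (\<forall>t\<ge>0.
     ((\<lambda>s. L2_norm (\<lambda>x. (u s x - u t x) /\<^sub>R (s - t) - v t x)) \<longlongrightarrow> 0) (at t within {0..}))"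

definition C1_L2 :: "(real \<Rightarrow> real ^ 'n \<Rightarrow> complex) \<Rightarrow> bool" where
  "C1_L2 u \<longleftrightarrow> continuous_L2 u \<and> (\<exists>v. continuous_L2 v \<and> has_L2_derivative u v)"

text \<open>The multiplier of the operator L = log (I + (-Laplacian)^(1/2)).\<close>

definition L_symbol :: "real ^ 'n \<Rightarrow> real" where
  "L_symbol \<xi> = ln (1 + norm \<xi>)"

text \<open>
  The mild solution of \<open>u_tt - Laplacian u + 2 L u_t = 0\<close>: a curve in C([0,oo); H1) and
  C1([0,oo); L2) whose Fourier transform in x solves, for almost every frequency, the
  initial value problem for \<open>w_tt + 2 log(1+|xi|) w_t + |xi|^2 w = 0\<close>. As the transform of
  \<open>u t\<close> is determined only up to a null set depending on t, the ODE is imposed on a version w of it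
  (with \<open>w'\<close> its time derivative).
\<close>

definition mild_solution ::
    "(real ^ 'n \<Rightarrow> complex) \<Rightarrow> (real ^ 'n \<Rightarrow> complex) \<Rightarrow> (real \<Rightarrow> real ^ 'n \<Rightarrow> complex) \<Rightarrow> bool" where
  "mild_solution u0 u1 u \<longleftrightarrow> continuous_H1 u \<and> C1_L2 u \<and>
     (\<exists>w w'.
        (\<forall>t\<ge>0. AE \<xi> in lebesgue. w t \<xi> = L2_fourier (u t) \<xi>) \<and>
        (AE \<xi> in lebesgue.
           w 0 \<xi> = L2_fourier u0 \<xi> \<and> w' 0 \<xi> = L2_fourier u1 \<xi> \<and>
           (\<forall>t\<ge>0.
              ((\<lambda>s. w s \<xi>) has_vector_derivative w' t \<xi>) (at t within {0..}) \<and>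
              ((\<lambda>s. w' s \<xi>) has_vector_derivative
                 - (of_real (2 * L_symbol \<xi>) * w' t \<xi>) - of_real ((norm \<xi>)\<^sup>2) * w t \<xi>)
                (at t within {0..}))))"

text \<open>The asymptotic profile; the argument P is the integral of the initial velocity.\<close>

definition profile :: "complex \<Rightarrow> real \<Rightarrow> real ^ 'n \<Rightarrow> complex" where
  "profile P t \<xi> =
     (let r = norm \<xi>; b = sqrt (r\<^sup>2 - (ln (1 + r))\<^sup>2)
      in of_real ((1 + r) powr (- t) * (1 / b) * sin (t * b)) * P)"

end

theory Submission
  imports Defs "HOL-Probability.Characteristic_Functions" "HOL-Probability.Sinc_Integral"
begin

text \<open>
  After a Fourier transform in space the equation becomes, at each frequency \<open>\<xi>\<close> with \<open>r = norm \<xi>\<close>, a damped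
  oscillator with damping constant \<open>a = ln (1 + r)\<close> and frequency \<open>b = sqrt (r\<^sup>2 - a\<^sup>2)\<close>. Its solution is explicit,
    \<open>w t = exp (- a t) * (cos (b t) * w 0 + sin (b t) / b * (w' 0 + a * w 0))\<close>,
  and the profile is the part of it obtained from \<open>w 0 = 0\<close> and \<open>w' 0 = P\<close>, with P the transform of the initial
  velocity at frequency 0. In the difference, \<open>w 0\<close> is bounded by the L1 norm of the initial position, and
  \<open>w' 0 - P\<close> is bounded by r times the weighted L1 norm of the initial velocity, since the first moment controls
  the gradient of its transform. With \<open>\<bar>sin (b t) / b\<bar> \<le> t\<close> and \<open>a \<le> r\<close> the difference is therefore at most
    \<open>(1 + r) powr (- t) * (1 + t * r)\<close>
  times the sum of these norms (\<open>mode_estimate\<close>). For t large this weight is dominated by a fixed decreasing function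
  of \<open>t * r\<close>, so its L2 norm over n-dimensional frequency space is of order \<open>t powr (- n / 2)\<close> (\<open>decay_weight_L2\<close>).

  The estimate is carried back to the space side by Plancherel's theorem (\<open>plancherel\<close>). For a function that is
  integrable and square-integrable, the energy of the transform, damped by a Gaussian, is a quadratic form with the
  heat kernel. Schur's test bounds it; for continuous functions with compact support it converges to the energy of the
  function as the damping is removed, and density gives the equality in general. Plancherel's theorem and the
  completeness of L2 show that the limit in mean in the definition of \<open>L2_fourier\<close> exists, and that it agrees with the
  Fourier integral where both make sense.

  The distance between u and the inverse transform of the profile is that of their transforms, up to a constant:
    \<open>L2_norm (u - inv_fourier g) = L2_norm (fourier u - g) / sqrt ((2 * pi) ^ n)\<close>
  for u and g that are integrable and square-integrable (\<open>L2_norm_diff_inv_fourier\<close>); cutting u off to balls extends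
  this, as an upper bound, to all square-integrable u. Expanding the squares, the equation follows from Plancherel's
  theorem for u and for g separately and from the exchange of a transform between two factors of an integral.
\<close>

section \<open>The space of square-integrable functions\<close>

text \<open>
  Makes Fubini and Tonelli available on products of the completed measure, hence directly for Lebesgue
  measurable integrands.
\<close>

lemma sigma_finite_lebesgue: "sigma_finite_measure (lebesgue :: 'a::euclidean_space measure)"
proof -
  obtain A :: "'a set set" where "countable A" "A \<subseteq> sets lborel" "\<Union>A = space lborel"
      "\<forall>a\<in>A. emeasure lborel a \<noteq> \<infinity>"
    using lborel.sigma_finite_countable by blast
  then show ?thesis
    by (intro sigma_finite_measure.intro exI[of _ A]) auto
qed

interpretation lebesgue: sigma_finite_measure "lebesgue :: 'a::euclidean_space measure"
  by (rule sigma_finite_lebesgue)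

interpretation lebesgue_pair: pair_sigma_finite
  "lebesgue :: 'a::euclidean_space measure" "lebesgue :: 'b::euclidean_space measure" ..

lemma in_L2_measurable [measurable_dest]: "in_L2 f \<Longrightarrow> f \<in> borel_measurable lebesgue"
  by (simp add: in_L2_def)

lemma in_L2_integrable: "in_L2 f \<Longrightarrow> integrable lebesgue (\<lambda>x. (norm (f x))\<^sup>2)"
  by (simp add: in_L2_def)

lemma in_L2_iff_nn_integral:
  "in_L2 f \<longleftrightarrow> f \<in> borel_measurable lebesgue \<and> (\<integral>\<^sup>+x. ennreal ((norm (f x))\<^sup>2) \<partial>lebesgue) < \<infinity>"
  by (auto simp: in_L2_def integrable_iff_bounded)

lemma nn_integral_L2_norm:
  "in_L2 f \<Longrightarrow> (\<integral>\<^sup>+x. ennreal ((norm (f x))\<^sup>2) \<partial>lebesgue) = ennreal ((L2_norm f)\<^sup>2)"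
  by (subst nn_integral_eq_integral) (auto simp: in_L2_def L2_norm_def)

lemma L2_norm_nonneg [simp]: "0 \<le> L2_norm f"
  by (simp add: L2_norm_def)

lemma L2_norm_power2: "(L2_norm f)\<^sup>2 = (LINT x|lebesgue. (norm (f x))\<^sup>2)"
  by (simp add: L2_norm_def)

text \<open>
  The workhorse for membership in the space: domination by a multiple of a member.
\<close>

lemma in_L2_AE_le:
  assumes "in_L2 g" "f \<in> borel_measurable lebesgue" "AE x in lebesgue. norm (f x) \<le> c * norm (g x)"
  shows "in_L2 f"
  unfolding in_L2_def
proof (intro conjI)
  show "integrable lebesgue (\<lambda>x. (norm (f x))\<^sup>2)"
  proof (rule Bochner_Integration.integrable_bound)
    show "integrable lebesgue (\<lambda>x. c\<^sup>2 * (norm (g x))\<^sup>2)"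
      using in_L2_integrable[OF assms(1)] by simp
    show "AE x in lebesgue. norm ((norm (f x))\<^sup>2) \<le> norm (c\<^sup>2 * (norm (g x))\<^sup>2)"
      using assms(3)
    proof eventually_elim
      case (elim x)
      then have "(norm (f x))\<^sup>2 \<le> (c * norm (g x))\<^sup>2" by (intro power_mono) auto
      then show ?case by (simp add: power_mult_distrib)
    qed
  qed (use assms in simp)
qed fact

lemma norm_add_power2_le: "(norm (a + b))\<^sup>2 \<le> 2 * (norm a)\<^sup>2 + 2 * (norm (b::'a::real_normed_vector))\<^sup>2"
proof -
  have "(norm (a + b))\<^sup>2 \<le> (norm a + norm b)\<^sup>2"
    by (intro power_mono norm_triangle_ineq) auto
  also have "\<dots> \<le> 2 * (norm a)\<^sup>2 + 2 * (norm b)\<^sup>2"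
    using sum_squares_bound[of "norm a" "norm b"] by (simp add: power2_sum)
  finally show ?thesis .
qed

lemma in_L2_add:
  assumes "in_L2 f" "in_L2 g"
  shows "in_L2 (\<lambda>x. f x + g x)"
  unfolding in_L2_def
proof (intro conjI)
  show "integrable lebesgue (\<lambda>x. (norm (f x + g x))\<^sup>2)"
  proof (rule Bochner_Integration.integrable_bound)
    show "integrable lebesgue (\<lambda>x. 2 * (norm (f x))\<^sup>2 + 2 * (norm (g x))\<^sup>2)"
      using assms[THEN in_L2_integrable] by simp
    show "AE x in lebesgue. norm ((norm (f x + g x))\<^sup>2) \<le> norm (2 * (norm (f x))\<^sup>2 + 2 * (norm (g x))\<^sup>2)"
      using norm_add_power2_le by (intro AE_I2) (auto intro: order_trans)
  qed (use assms[THEN in_L2_measurable] in simp)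
qed (use assms[THEN in_L2_measurable] in simp)

lemma in_L2_uminus: "in_L2 f \<Longrightarrow> in_L2 (\<lambda>x. - f x)"
  by (simp add: in_L2_def)

lemma in_L2_diff: "in_L2 f \<Longrightarrow> in_L2 g \<Longrightarrow> in_L2 (\<lambda>x. f x - g x)"
  using in_L2_add[of f "\<lambda>x. - g x"] in_L2_uminus by auto

lemma in_L2_cmult: "in_L2 f \<Longrightarrow> in_L2 (\<lambda>x. c * f x)"
  by (auto simp: in_L2_def norm_mult power_mult_distrib)

lemma L2_norm_cmult: "L2_norm (\<lambda>x. c * f x) = norm c * L2_norm f"
  by (simp add: L2_norm_def norm_mult power_mult_distrib real_sqrt_mult)

lemma L2_norm_minus_commute: "L2_norm (\<lambda>x. f x - g x) = L2_norm (\<lambda>x. g x - f x)"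
  by (simp add: L2_norm_def norm_minus_commute)

lemma integrable_mult_L2:
  assumes "in_L2 f" "in_L2 g"
  shows "integrable lebesgue (\<lambda>x. f x * g x)"
proof (rule Bochner_Integration.integrable_bound)
  show "integrable lebesgue (\<lambda>x. (norm (f x))\<^sup>2 + (norm (g x))\<^sup>2)"
    using assms[THEN in_L2_integrable] by simp
  have "norm (f x * g x) \<le> norm ((norm (f x))\<^sup>2 + (norm (g x))\<^sup>2)" for x
  proof -
    have "norm (f x) * norm (g x) \<le> 2 * norm (f x) * norm (g x)" by simp
    also have "\<dots> \<le> (norm (f x))\<^sup>2 + (norm (g x))\<^sup>2" by (rule sum_squares_bound)
    finally show ?thesis by (simp add: norm_mult)
  qed
  then show "AE x in lebesgue. norm (f x * g x) \<le> norm ((norm (f x))\<^sup>2 + (norm (g x))\<^sup>2)"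
    by simp
qed (use assms[THEN in_L2_measurable] in simp)

lemma L2_Cauchy_Schwarz:
  assumes "in_L2 f" "in_L2 g"
  shows "(LINT x|lebesgue. norm (f x * g x)) \<le> L2_norm f * L2_norm g"
proof -
  have [measurable]: "f \<in> borel_measurable lebesgue" "g \<in> borel_measurable lebesgue"
    using assms by (auto dest: in_L2_measurable)
  have "(ennreal (LINT x|lebesgue. norm (f x * g x)))\<^sup>2
      = (\<integral>\<^sup>+x. ennreal (norm (f x)) * ennreal (norm (g x)) \<partial>lebesgue)\<^sup>2"
    using integrable_norm[OF integrable_mult_L2[OF assms]]
    by (subst nn_integral_eq_integral[symmetric]) (auto simp: norm_mult ennreal_mult)
  also have "\<dots> \<le> (\<integral>\<^sup>+x. (ennreal (norm (f x)))\<^sup>2 \<partial>lebesgue) * (\<integral>\<^sup>+x. (ennreal (norm (g x)))\<^sup>2 \<partial>lebesgue)"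
    by (rule Cauchy_Schwarz_nn_integral) auto
  also have "\<dots> = ennreal ((L2_norm f)\<^sup>2 * (L2_norm g)\<^sup>2)"
    using nn_integral_L2_norm[OF assms(1)] nn_integral_L2_norm[OF assms(2)]
    by (simp add: ennreal_power ennreal_mult)
  finally have "(LINT x|lebesgue. norm (f x * g x))\<^sup>2 \<le> (L2_norm f * L2_norm g)\<^sup>2"
    by (simp add: ennreal_power power_mult_distrib)
  then show ?thesis
    by (rule power2_le_imp_le) simp
qed

text \<open>
  Minkowski's inequality: expand the square and bound the mixed term by Cauchy-Schwarz.
\<close>

lemma L2_norm_triangle:
  assumes "in_L2 f" "in_L2 g"
  shows "L2_norm (\<lambda>x. f x + g x) \<le> L2_norm f + L2_norm g"
proof (rule power2_le_imp_le)
  note [simp] = assms[THEN in_L2_integrable] integrable_norm[OF integrable_mult_L2[OF assms]]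
  have "(L2_norm (\<lambda>x. f x + g x))\<^sup>2
      \<le> (LINT x|lebesgue. (norm (f x))\<^sup>2 + (norm (g x))\<^sup>2 + 2 * norm (f x * g x))"
    unfolding L2_norm_power2
  proof (rule integral_mono)
    show "integrable lebesgue (\<lambda>x. (norm (f x + g x))\<^sup>2)"
      using in_L2_add[OF assms] by (rule in_L2_integrable)
    show "integrable lebesgue (\<lambda>x. (norm (f x))\<^sup>2 + (norm (g x))\<^sup>2 + 2 * norm (f x * g x))"
      by (intro Bochner_Integration.integrable_add integrable_mult_right) simp_all
    fix x
    have "(norm (f x + g x))\<^sup>2 \<le> (norm (f x) + norm (g x))\<^sup>2"
      by (intro power_mono norm_triangle_ineq) auto
    then show "(norm (f x + g x))\<^sup>2 \<le> (norm (f x))\<^sup>2 + (norm (g x))\<^sup>2 + 2 * norm (f x * g x)"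
      by (simp add: power2_sum norm_mult)
  qed
  also have "\<dots> = (L2_norm f)\<^sup>2 + (L2_norm g)\<^sup>2 + 2 * (LINT x|lebesgue. norm (f x * g x))"
    by (simp add: L2_norm_power2 Bochner_Integration.integral_add)
  also have "\<dots> \<le> (L2_norm f + L2_norm g)\<^sup>2"
    using L2_Cauchy_Schwarz[OF assms] by (simp add: power2_sum)
  finally show "(L2_norm (\<lambda>x. f x + g x))\<^sup>2 \<le> (L2_norm f + L2_norm g)\<^sup>2" .
qed simp

lemma L2_norm_triangle_diff:
  assumes "in_L2 f" "in_L2 g" "in_L2 h"
  shows "L2_norm (\<lambda>x. f x - h x) \<le> L2_norm (\<lambda>x. f x - g x) + L2_norm (\<lambda>x. g x - h x)"
  using L2_norm_triangle[OF in_L2_diff[OF assms(1,2)] in_L2_diff[OF assms(2,3)]] by simp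

lemma L2_norm_eq_0_imp_AE:
  assumes "in_L2 f" "L2_norm f = 0"
  shows "AE x in lebesgue. f x = 0"
proof -
  have "(LINT x|lebesgue. (norm (f x))\<^sup>2) = 0"
    using assms(2) by (simp add: L2_norm_def)
  then have "AE x in lebesgue. (norm (f x))\<^sup>2 = 0"
    using in_L2_integrable[OF assms(1)] by (subst (asm) integral_nonneg_eq_0_iff_AE) auto
  then show ?thesis by simp
qed

lemma L2_norm_AE_mono:
  assumes "in_L2 f" "in_L2 g" "AE x in lebesgue. norm (f x) \<le> norm (g x)"
  shows "L2_norm f \<le> L2_norm g"
  unfolding L2_norm_def
proof (intro real_sqrt_le_mono integral_mono_AE)
  show "AE x in lebesgue. (norm (f x))\<^sup>2 \<le> (norm (g x))\<^sup>2"
    using assms(3) by eventually_elim (auto intro: power_mono)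
qed (intro in_L2_integrable assms)+

text \<open>
  The pointwise part of the completeness proof: a geometric bound on the increments gives a geometric
  bound on the distance to the limit, by summing the tail of the telescoping series.
\<close>

lemma rapidly_Cauchy_limit_bound:
  fixes F :: "nat \<Rightarrow> 'a::banach"
  assumes "\<And>j. norm (F (Suc j) - F j) \<le> K * (1/2) ^ j"
  shows "norm (F k - lim F) \<le> 2 * K * (1/2) ^ k"
proof -
  define d where "d j = F (Suc j) - F j" for j
  have geo: "summable (\<lambda>j. K * (1/2) ^ j :: real)"
    by (intro summable_mult summable_geometric) simp
  have dle: "norm (d j) \<le> K * (1/2) ^ j" for j
    using assms by (simp add: d_def)
  have sd: "summable d"
    by (rule summable_comparison_test'[OF geo]) (rule dle)
  have F: "F m = F 0 + (\<Sum>j<m. d j)" for m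
    unfolding d_def by (simp add: sum_lessThan_telescope)
  have "(\<lambda>m. F 0 + (\<Sum>j<m. d j)) \<longlonglongrightarrow> F 0 + suminf d"
    by (intro tendsto_intros summable_LIMSEQ sd)
  then have lim: "F \<longlonglongrightarrow> F 0 + suminf d"
    using F by (subst (asm) F[symmetric])
  have "lim F - F k = suminf d - (\<Sum>j<k. d j)"
    using limI[OF lim] F[of k] by simp
  also have "\<dots> = (\<Sum>j. d (j + k))"
    by (simp add: suminf_minus_initial_segment sd)
  also have "norm \<dots> \<le> (\<Sum>j. K * (1/2) ^ k * (1/2) ^ j)"
  proof (rule norm_suminf_le)
    show "norm (d (j + k)) \<le> K * (1/2) ^ k * (1/2) ^ j" for j
      using dle[of "j + k"] by (simp add: power_add mult_ac)
    show "summable (\<lambda>j. K * (1/2) ^ k * (1/2) ^ j :: real)"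
      by (intro summable_mult summable_geometric) simp
  qed
  also have "\<dots> = K * (1/2) ^ k * (\<Sum>j. (1/2) ^ j)"
    by (intro suminf_mult summable_geometric) simp
  also have "\<dots> = 2 * K * (1/2) ^ k"
    by (simp add: suminf_geometric)
  finally show "norm (F k - lim F) \<le> 2 * K * (1/2) ^ k"
    by (simp add: norm_minus_commute)
qed

text \<open>
  Completeness for rapidly converging sequences. The weighted series H of the squared increments has a
  finite integral, hence is finite almost everywhere; where it is finite, the increments are bounded by
  a geometric sequence with factor sqrt H, so the sequence converges pointwise, at a rate whose square
  is again controlled by H and can therefore be integrated.
\<close>

lemma L2_complete_rapid:
  assumes F: "\<And>k. in_L2 (F k)" and dF: "\<And>k. L2_norm (\<lambda>x. F (Suc k) x - F k x) \<le> (1/4) ^ k"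
  shows "\<exists>g. in_L2 g \<and> (\<lambda>k. L2_norm (\<lambda>x. F k x - g x)) \<longlonglongrightarrow> 0"
proof -
  have [measurable]: "\<And>k. F k \<in> borel_measurable lebesgue"
    using F by (auto dest: in_L2_measurable)
  \<comment> \<open>Weighting by \<open>4 ^ k\<close> leaves integrals of size at most \<open>(1/4) ^ k\<close>, and where H is finite it still
    forces increments of size \<open>(1/2) ^ k\<close>.\<close>
  define H where "H x = (\<Sum>k. ennreal (4 ^ k * (norm (F (Suc k) x - F k x))\<^sup>2))" for x
  have [measurable]: "H \<in> borel_measurable lebesgue"
    unfolding H_def by measurable
  define S where "S = (\<integral>\<^sup>+x. H x \<partial>lebesgue)"
  have int: "(\<integral>\<^sup>+x. ennreal (4 ^ k * (norm (F (Suc k) x - F k x))\<^sup>2) \<partial>lebesgue) \<le> ennreal ((1/4) ^ k)" for k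
  proof -
    have "(\<integral>\<^sup>+x. ennreal (4 ^ k * (norm (F (Suc k) x - F k x))\<^sup>2) \<partial>lebesgue)
        = ennreal (4 ^ k) * (\<integral>\<^sup>+x. ennreal ((norm (F (Suc k) x - F k x))\<^sup>2) \<partial>lebesgue)"
      by (subst nn_integral_cmult[symmetric]) (auto simp: ennreal_mult)
    also have "\<dots> = ennreal (4 ^ k * (L2_norm (\<lambda>x. F (Suc k) x - F k x))\<^sup>2)"
      by (subst nn_integral_L2_norm) (auto intro: in_L2_diff F simp: ennreal_mult)
    also have "\<dots> \<le> ennreal (4 ^ k * ((1/4) ^ k)\<^sup>2)"
      by (intro ennreal_leI mult_left_mono power_mono dF) auto
    also have "4 ^ k * ((1/4) ^ k)\<^sup>2 = ((1/4) ^ k :: real)"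
      by (simp add: power2_eq_square power_divide)
    finally show ?thesis .
  qed
  have "S = (\<Sum>k. \<integral>\<^sup>+x. ennreal (4 ^ k * (norm (F (Suc k) x - F k x))\<^sup>2) \<partial>lebesgue)"
    unfolding S_def H_def by (rule nn_integral_suminf) measurable
  also have "\<dots> \<le> (\<Sum>k. ennreal ((1/4) ^ k))"
    by (intro suminf_le int) auto
  also have "\<dots> = ennreal (\<Sum>k. (1/4) ^ k)"
    by (intro suminf_ennreal_eq summable_sums summable_geometric) auto
  finally have "S \<le> ennreal (\<Sum>k. (1/4) ^ k)" .
  then have S: "S < \<infinity>"
    by (rule order_le_less_trans) simp
  define g where "g x = lim (\<lambda>k. F k x)" for x
  have [measurable]: "g \<in> borel_measurable lebesgue"
    unfolding g_def by measurable
  have "AE x in lebesgue. H x \<noteq> \<infinity>"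
    using S unfolding S_def by (intro nn_integral_PInf_AE) auto
  then have bound: "AE x in lebesgue. \<forall>k. ennreal ((norm (F k x - g x))\<^sup>2) \<le> ennreal (4 * (1/4) ^ k) * H x"
  proof eventually_elim
    case (elim x)
    have sm: "summable (\<lambda>k. 4 ^ k * (norm (F (Suc k) x - F k x))\<^sup>2)"
      using elim unfolding H_def by (intro summable_suminf_not_top) auto
    define h where "h = (\<Sum>k. 4 ^ k * (norm (F (Suc k) x - F k x))\<^sup>2)"
    have Hh: "H x = ennreal h" and h0: "0 \<le> h"
      unfolding H_def h_def using sm
      by (auto intro!: suminf_ennreal_eq summable_sums suminf_nonneg)
    have "norm (F (Suc k) x - F k x) \<le> sqrt h * (1/2) ^ k" for k
    proof -
      have pow4: "(4::real) ^ k = (2 ^ k)\<^sup>2"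
        by (simp add: power2_eq_square flip: power_mult_distrib)
      have "4 ^ k * (norm (F (Suc k) x - F k x))\<^sup>2 \<le> h"
        unfolding h_def using sum_le_suminf[OF sm, of "{k}"] by simp
      then have "(2 ^ k * norm (F (Suc k) x - F k x))\<^sup>2 \<le> h"
        by (simp add: power_mult_distrib pow4)
      then have "2 ^ k * norm (F (Suc k) x - F k x) \<le> sqrt h"
        by (rule real_le_rsqrt)
      then show ?thesis by (simp add: field_simps power_divide)
    qed
    from rapidly_Cauchy_limit_bound[of "\<lambda>k. F k x", OF this]
    have *: "norm (F k x - g x) \<le> 2 * sqrt h * (1/2) ^ k" for k
      unfolding g_def .
    show ?case
    proof
      fix k
      have "(norm (F k x - g x))\<^sup>2 \<le> (2 * sqrt h * (1/2) ^ k)\<^sup>2"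
        by (intro power_mono *) auto
      also have "\<dots> = 4 * (1/4) ^ k * h"
        using h0 by (simp add: power_mult_distrib)
          (simp add: power2_eq_square flip: power_mult_distrib)
      finally show "ennreal ((norm (F k x - g x))\<^sup>2) \<le> ennreal (4 * (1/4) ^ k) * H x"
        using h0 unfolding Hh by (subst ennreal_mult[symmetric]) (auto intro: ennreal_leI)
    qed
  qed
  have le: "(\<integral>\<^sup>+x. ennreal ((norm (F k x - g x))\<^sup>2) \<partial>lebesgue) \<le> ennreal (4 * (1/4) ^ k) * S" for k
  proof -
    have "(\<integral>\<^sup>+x. ennreal ((norm (F k x - g x))\<^sup>2) \<partial>lebesgue) \<le> (\<integral>\<^sup>+x. ennreal (4 * (1/4) ^ k) * H x \<partial>lebesgue)"
      using bound by (intro nn_integral_mono_AE) auto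
    then show ?thesis by (simp add: nn_integral_cmult S_def)
  qed
  have L2d: "in_L2 (\<lambda>x. F k x - g x)" for k
  proof -
    have "ennreal (4 * (1/4) ^ k) * S < \<infinity>"
      using S by (simp add: ennreal_mult_less_top)
    with le[of k] show ?thesis
      unfolding in_L2_iff_nn_integral by auto
  qed
  have "in_L2 (\<lambda>x. F 0 x - (F 0 x - g x))"
    by (intro in_L2_diff F L2d)
  then have g: "in_L2 g" by simp
  obtain s where s: "S = ennreal s" "0 \<le> s"
    using S by (cases S) auto
  have sq: "(L2_norm (\<lambda>x. F k x - g x))\<^sup>2 \<le> 4 * (1/4) ^ k * s" for k
    using le[of k] s by (subst (asm) nn_integral_L2_norm[OF L2d]) (simp add: ennreal_mult[symmetric])
  have "(\<lambda>k. 4 * (1/4) ^ k * s) \<longlonglongrightarrow> 4 * 0 * s"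
    by (intro tendsto_intros LIMSEQ_power_zero) auto
  then have null: "(\<lambda>k. 4 * (1/4) ^ k * s) \<longlonglongrightarrow> 0"
    by simp
  have "(\<lambda>k. (L2_norm (\<lambda>x. F k x - g x))\<^sup>2) \<longlonglongrightarrow> 0"
    by (rule Lim_null_comparison[OF _ null]) (simp add: sq)
  from tendsto_real_sqrt[OF this]
  have "(\<lambda>k. L2_norm (\<lambda>x. F k x - g x)) \<longlonglongrightarrow> 0" by simp
  then show ?thesis using g by blast
qed

text \<open>
  Completeness along a real parameter tending to infinity, the form in which the Fourier transform of a
  square-integrable function is defined. A rapidly converging sequence of parameters provides the limit.
\<close>

lemma L2_complete_at_top:
  fixes G :: "real \<Rightarrow> real ^ 'n \<Rightarrow> complex"
  assumes G: "\<And>R. in_L2 (G R)"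
    and Cauchy: "\<And>e. e > 0 \<Longrightarrow> \<exists>r. \<forall>R\<ge>r. \<forall>R'\<ge>r. L2_norm (\<lambda>x. G R x - G R' x) \<le> e"
  shows "\<exists>g. in_L2 g \<and> ((\<lambda>R. L2_norm (\<lambda>x. G R x - g x)) \<longlongrightarrow> 0) at_top"
proof -
  have "\<exists>r. \<forall>k. \<forall>R\<ge>r k. \<forall>R'\<ge>r k. L2_norm (\<lambda>x. G R x - G R' x) \<le> (1/4) ^ k"
    using Cauchy by (intro choice) auto
  then obtain r where r: "\<And>k R R'. R \<ge> r k \<Longrightarrow> R' \<ge> r k \<Longrightarrow> L2_norm (\<lambda>x. G R x - G R' x) \<le> (1/4) ^ k"
    by blast
  \<comment> \<open>The thresholds r k may fail to be monotone; their running maximum is.\<close>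
  define \<rho> where "\<rho> k = Max (r ` {..k})" for k
  have \<rho>: "r j \<le> \<rho> k" if "j \<le> k" for j k
    unfolding \<rho>_def using that by (intro Max_ge) auto
  obtain g where g: "in_L2 g" "(\<lambda>k. L2_norm (\<lambda>x. G (\<rho> k) x - g x)) \<longlonglongrightarrow> 0"
    using L2_complete_rapid[of "\<lambda>k. G (\<rho> k)", OF G r] \<rho> by auto
  have "((\<lambda>R. L2_norm (\<lambda>x. G R x - g x)) \<longlongrightarrow> 0) at_top"
  proof (rule tendstoI)
    fix e :: real assume e: "e > 0"
    have "eventually (\<lambda>k. L2_norm (\<lambda>x. G (\<rho> k) x - g x) < e / 2) sequentially"
      using e order_tendstoD(2)[OF g(2), of "e/2"] by simp
    moreover have "(\<lambda>k. (1/4) ^ k :: real) \<longlonglongrightarrow> 0"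
      by (intro LIMSEQ_power_zero) auto
    then have "eventually (\<lambda>k. (1/4) ^ k < e / 2) sequentially"
      using e order_tendstoD(2)[of _ 0 _ "e/2"] by simp
    ultimately have "eventually (\<lambda>k. L2_norm (\<lambda>x. G (\<rho> k) x - g x) < e / 2 \<and> (1/4) ^ k < e / 2) sequentially"
      by (rule eventually_conj)
    then obtain k where k: "L2_norm (\<lambda>x. G (\<rho> k) x - g x) < e / 2" "(1/4) ^ k < e / 2"
      using eventually_happens' sequentially_bot by blast
    show "\<forall>\<^sub>F R in at_top. dist (L2_norm (\<lambda>x. G R x - g x)) 0 < e"
      using eventually_ge_at_top[of "r k"]
    proof eventually_elim
      case (elim R)
      have "L2_norm (\<lambda>x. G R x - g x) \<le> L2_norm (\<lambda>x. G R x - G (\<rho> k) x) + L2_norm (\<lambda>x. G (\<rho> k) x - g x)"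
        by (intro L2_norm_triangle_diff G g)
      also have "\<dots> < e"
        using r[OF elim \<rho>[of k k]] k by simp
      finally show ?case by simp
    qed
  qed
  with g(1) show ?thesis by blast
qed

section \<open>Density of the continuous functions with compact support\<close>

lemma borel_measurable_lebesgue_id:
  "(\<lambda>x. x) \<in> borel_measurable (lebesgue :: 'a::euclidean_space measure)"
  by (auto intro!: measurable_completion)

lemma L2_dominated_convergence:
  fixes F :: "nat \<Rightarrow> real ^ 'n \<Rightarrow> complex"
  assumes [measurable]: "\<And>k. F k \<in> borel_measurable lebesgue" "f \<in> borel_measurable lebesgue"
    and w: "integrable lebesgue w"
    and lim: "AE x in lebesgue. (\<lambda>k. F k x) \<longlonglongrightarrow> f x"
    and le: "\<And>k. AE x in lebesgue. (norm (F k x - f x))\<^sup>2 \<le> w x"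
  shows "(\<lambda>k. L2_norm (\<lambda>x. F k x - f x)) \<longlonglongrightarrow> 0"
proof -
  have "(\<lambda>k. LINT x|lebesgue. (norm (F k x - f x))\<^sup>2) \<longlonglongrightarrow> (LINT x|(lebesgue :: (real^'n) measure). 0)"
  proof (rule integral_dominated_convergence[OF _ _ w])
    show "AE x in lebesgue. (\<lambda>k. (norm (F k x - f x))\<^sup>2) \<longlonglongrightarrow> 0"
      using lim
    proof eventually_elim
      case (elim x)
      have "(\<lambda>k. (norm (F k x - f x))\<^sup>2) \<longlonglongrightarrow> (norm (f x - f x))\<^sup>2"
        by (intro tendsto_intros elim)
      then show ?case by simp
    qed
  qed (use le in simp_all)
  from tendsto_real_sqrt[OF this] show ?thesis
    by (simp add: L2_norm_def)
qed

text \<open>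
  The radial retraction of the complex plane onto the closed disc of radius M. It replaces a cut-off by
  cases, which would destroy continuity.
\<close>

definition truncate :: "real \<Rightarrow> complex \<Rightarrow> complex" where
  "truncate M z = of_real (M / max M (norm z)) * z"

lemma truncate_id: "M > 0 \<Longrightarrow> norm z \<le> M \<Longrightarrow> truncate M z = z"
  by (simp add: truncate_def max_absorb1)

lemma norm_truncate_le: "M > 0 \<Longrightarrow> norm (truncate M z) \<le> M"
  by (simp add: truncate_def norm_mult norm_divide divide_simps max_def)

lemma continuous_on_truncate:
  assumes "M > 0" "continuous_on UNIV g"
  shows "continuous_on UNIV (\<lambda>x. truncate M (g x))"
  unfolding truncate_def using assms by (intro continuous_intros) (auto simp: max_def)

lemma tendsto_truncate: "M > 0 \<Longrightarrow> (g \<longlongrightarrow> l) F \<Longrightarrow> ((\<lambda>x. truncate M (g x)) \<longlongrightarrow> truncate M l) F"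
  unfolding truncate_def by (intro tendsto_intros) (auto simp: max_def)

definition cutoff :: "real \<Rightarrow> 'a::real_normed_vector \<Rightarrow> real" where
  "cutoff R x = max 0 (min 1 (R + 1 - norm x))"

lemma cutoff_bounds: "0 \<le> cutoff R x" "cutoff R x \<le> 1"
  by (auto simp: cutoff_def)

lemma cutoff_eq_1: "norm x \<le> R \<Longrightarrow> cutoff R x = 1"
  by (auto simp: cutoff_def)

lemma cutoff_eq_0: "norm x > R + 1 \<Longrightarrow> cutoff R x = 0"
  by (auto simp: cutoff_def)

lemma continuous_on_cutoff: "continuous_on UNIV (cutoff R)"
  unfolding cutoff_def by (intro continuous_intros)

definition continuous_compact_support :: "(real ^ 'n \<Rightarrow> complex) \<Rightarrow> bool" where
  "continuous_compact_support g \<longleftrightarrow> continuous_on UNIV g \<and> (\<exists>R. \<forall>x. norm x > R \<longrightarrow> g x = 0)"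

lemma integrable_indicator_cball:
  "integrable lebesgue (\<lambda>x::real^'n. c * indicat_real (cball 0 R) x)"
  using emeasure_bounded_finite[OF bounded_cball, of "0::real^'n" R]
  by (intro integrable_mult_right integrable_real_indicator) (auto simp: infinity_ennreal_def)

lemma integrable_bounded_support:
  fixes f :: "real ^ 'n \<Rightarrow> 'b::{banach, second_countable_topology}"
  assumes "f \<in> borel_measurable lebesgue" "\<And>x. norm (f x) \<le> B" "\<And>x. norm x > R \<Longrightarrow> f x = 0"
  shows "integrable lebesgue f"
proof (rule Bochner_Integration.integrable_bound[OF integrable_indicator_cball[of B R]])
  have "norm (f x) \<le> norm (B * indicat_real (cball 0 R) x)" for x
    using assms(2)[of x] assms(3)[of x] by (auto simp: indicator_def)
  then show "AE x in lebesgue. norm (f x) \<le> norm (B * indicat_real (cball 0 R) x)" by simp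
qed fact

lemma continuous_compact_support_bounded:
  assumes "continuous_compact_support g"
  obtains B where "B > 0" "\<And>x. norm (g x) \<le> B"
proof -
  obtain R where R: "\<And>x. norm x > R \<Longrightarrow> g x = 0" and c: "continuous_on UNIV g"
    using assms by (auto simp: continuous_compact_support_def)
  have "compact (g ` cball 0 R)"
    by (intro compact_continuous_image continuous_on_subset[OF c]) auto
  then obtain B where B: "B > 0" "\<And>y. y \<in> g ` cball 0 R \<Longrightarrow> norm y \<le> B"
    using compact_imp_bounded bounded_pos by metis
  have "norm (g x) \<le> B" for x
    using B(1) B(2)[of "g x"] R[of x] by (cases "norm x > R") auto
  with B(1) show ?thesis by (rule that)
qed

lemma continuous_compact_support_measurable:
  "continuous_compact_support g \<Longrightarrow> g \<in> borel_measurable lebesgue"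
  unfolding continuous_compact_support_def
  by (auto intro!: measurable_completion borel_measurable_continuous_onI)

lemma continuous_compact_support_integrable:
  assumes "continuous_compact_support g"
  shows "integrable lebesgue g" "in_L2 g"
proof -
  obtain R where R: "\<And>x. norm x > R \<Longrightarrow> g x = 0"
    using assms by (auto simp: continuous_compact_support_def)
  obtain B where B: "B > 0" "\<And>x. norm (g x) \<le> B"
    using continuous_compact_support_bounded[OF assms] by blast
  note m [measurable] = continuous_compact_support_measurable[OF assms]
  show "integrable lebesgue g"
    by (rule integrable_bounded_support[OF m B(2) R])
  have "integrable lebesgue (\<lambda>x. (norm (g x))\<^sup>2)"
    by (rule integrable_bounded_support[where B="B\<^sup>2" and R=R])
       (auto intro!: power_mono B(2) simp: R)
  then show "in_L2 g" by (simp add: in_L2_def)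
qed

text \<open>
  A bounded measurable function with bounded support is the almost everywhere limit of continuous
  functions (the Henstock-Kurzweil notion of measurability, which coincides with Lebesgue measurability).
  Truncating these in value and in space keeps them continuous and dominates them, so that dominated
  convergence applies.
\<close>

lemma continuous_compact_support_dense_bounded:
  fixes f :: "real ^ 'n \<Rightarrow> complex"
  assumes f [measurable]: "f \<in> borel_measurable lebesgue" and M: "M > 0"
    and le: "\<And>x. norm (f x) \<le> M" and supp: "\<And>x. norm x > R \<Longrightarrow> f x = 0" and e: "e > 0"
  shows "\<exists>g. continuous_compact_support g \<and> L2_norm (\<lambda>x. g x - f x) < e"
proof -
  have "f measurable_on UNIV"
    by (intro lebesgue_measurable_imp_measurable_on f) auto
  then obtain N g where N: "negligible N" and g: "\<And>n. continuous_on UNIV (g n)"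
    and lim: "\<And>x. x \<notin> N \<Longrightarrow> (\<lambda>n. g n x) \<longlonglongrightarrow> f x"
    by (auto simp: measurable_on_def)
  define h where "h n x = of_real (cutoff R x) * truncate M (g n x)" for n x
  have h: "continuous_compact_support (h n)" for n
    unfolding continuous_compact_support_def h_def
    by (intro conjI exI[of _ "R + 1"] continuous_intros continuous_on_cutoff continuous_on_truncate M g)
       (auto simp: cutoff_eq_0)
  note hm [measurable] = continuous_compact_support_measurable[OF h]
  have cf: "of_real (cutoff R x) * truncate M (f x) = f x" for x
    using supp[of x] truncate_id[OF M le[of x]] cutoff_eq_1[of x R]
    by (cases "norm x > R") auto
  have hle: "norm (h n x) \<le> M" for n x
  proof -
    have "norm (h n x) \<le> 1 * M"
      unfolding h_def norm_mult using cutoff_bounds[of R x]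
      by (intro mult_mono norm_truncate_le M) auto
    then show ?thesis by simp
  qed
  have "(\<lambda>n. L2_norm (\<lambda>x. h n x - f x)) \<longlonglongrightarrow> 0"
  proof (rule L2_dominated_convergence[OF hm f integrable_indicator_cball[of "(2 * M)\<^sup>2" "R + 1"]])
    have "AE x in lebesgue. x \<notin> N"
      using N by (auto simp: negligible_iff_null_sets intro: AE_not_in)
    then show "AE x in lebesgue. (\<lambda>n. h n x) \<longlonglongrightarrow> f x"
    proof eventually_elim
      case (elim x)
      have "(\<lambda>n. h n x) \<longlonglongrightarrow> of_real (cutoff R x) * truncate M (f x)"
        unfolding h_def by (intro tendsto_intros tendsto_truncate M lim elim)
      then show ?case by (simp add: cf)
    qed
    have "(norm (h n x - f x))\<^sup>2 \<le> (2 * M)\<^sup>2 * indicat_real (cball 0 (R + 1)) x" for n x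
    proof (cases "norm x > R + 1")
      case True
      then have "h n x = 0" "f x = 0"
        using supp[of x] by (auto simp: h_def cutoff_eq_0)
      then show ?thesis by simp
    next
      case False
      have "norm (h n x - f x) \<le> 2 * M"
        using norm_triangle_ineq4[of "h n x" "f x"] hle[of n x] le[of x] by linarith
      then have "(norm (h n x - f x))\<^sup>2 \<le> (2 * M)\<^sup>2"
        by (intro power_mono) auto
      then show ?thesis using False by simp
    qed
    then show "AE x in lebesgue. (norm (h n x - f x))\<^sup>2 \<le> (2 * M)\<^sup>2 * indicat_real (cball 0 (R + 1)) x" for n
      by simp
  qed
  then have "eventually (\<lambda>n. L2_norm (\<lambda>x. h n x - f x) < e) sequentially"
    using e by (rule order_tendstoD(2))
  then obtain n where "L2_norm (\<lambda>x. h n x - f x) < e"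
    using eventually_happens' sequentially_bot by blast
  with h show ?thesis by blast
qed

lemma continuous_compact_support_dense:
  fixes f :: "real ^ 'n \<Rightarrow> complex"
  assumes f: "in_L2 f" and e: "e > 0"
  shows "\<exists>g. continuous_compact_support g \<and> L2_norm (\<lambda>x. g x - f x) < e"
proof -
  note [measurable] = in_L2_measurable[OF f] borel_measurable_lebesgue_id
  define F where "F k x = (if norm x \<le> real k \<and> norm (f x) \<le> real k then f x else 0)" for k x
  have Fm [measurable]: "F k \<in> borel_measurable lebesgue" for k
    unfolding F_def by measurable
  have F: "in_L2 (F k)" for k
    by (rule in_L2_AE_le[OF f Fm, of _ 1]) (auto simp: F_def)
  have "(\<lambda>k. L2_norm (\<lambda>x. F k x - f x)) \<longlonglongrightarrow> 0"
  proof (rule L2_dominated_convergence[OF Fm in_L2_measurable[OF f] in_L2_integrable[OF f]])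
    have "(\<lambda>k. F k x) \<longlonglongrightarrow> f x" for x
    proof (rule tendsto_eventually)
      obtain k0 :: nat where "max (norm x) (norm (f x)) \<le> real k0"
        using real_arch_simple by blast
      then have "F k x = f x" if "k0 \<le> k" for k
        using that by (auto simp: F_def)
      then show "\<forall>\<^sub>F k in sequentially. F k x = f x"
        by (rule eventually_sequentiallyI)
    qed
    then show "AE x in lebesgue. (\<lambda>k. F k x) \<longlonglongrightarrow> f x" by simp
    show "AE x in lebesgue. (norm (F k x - f x))\<^sup>2 \<le> (norm (f x))\<^sup>2" for k
      by (auto simp: F_def)
  qed
  then have "eventually (\<lambda>k. L2_norm (\<lambda>x. F k x - f x) < e / 2) sequentially"
    using e by (intro order_tendstoD(2)) auto
  then obtain k where k: "L2_norm (\<lambda>x. F k x - f x) < e / 2"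
    using eventually_happens' sequentially_bot by blast
  have "norm (F k x) \<le> real k + 1" "norm x > real k \<Longrightarrow> F k x = 0" for x
    by (auto simp: F_def)
  then obtain g where g: "continuous_compact_support g" "L2_norm (\<lambda>x. g x - F k x) < e / 2"
    using continuous_compact_support_dense_bounded[OF Fm, of "real k + 1" k "real k" "e / 2"] e
    by auto
  have "L2_norm (\<lambda>x. g x - f x) \<le> L2_norm (\<lambda>x. g x - F k x) + L2_norm (\<lambda>x. F k x - f x)"
    by (intro L2_norm_triangle_diff F f continuous_compact_support_integrable(2) g)
  with g k show ?thesis by (intro exI[of _ g]) auto
qed

section \<open>The Fourier transform of integrable functions\<close>

lemma borel_measurable_lebesgueI:
  "f \<in> borel_measurable borel \<Longrightarrow> f \<in> borel_measurable (lebesgue :: 'a::euclidean_space measure)"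
  by (auto intro: measurable_completion)

lemma norm_exp_minus_ii [simp]: "norm (exp (- (\<i> * complex_of_real a))) = 1"
  using norm_exp_i_times[of "- a"] by simp

lemma fourier_kernel_measurable [measurable]:
  "(\<lambda>x. exp (- (\<i> * complex_of_real (x \<bullet> \<xi>)))) \<in> borel_measurable lebesgue"
  by (intro borel_measurable_lebesgueI) measurable

lemma fourier_integrand_integrable:
  assumes "integrable lebesgue f"
  shows "integrable lebesgue (\<lambda>x. exp (- (\<i> * of_real (x \<bullet> \<xi>))) * f x)"
  using assms borel_measurable_integrable[OF assms]
  by (intro Bochner_Integration.integrable_bound[OF assms]) (auto simp: norm_mult)

lemma norm_fourier_le: "norm (fourier f \<xi>) \<le> L1_norm f"
proof -
  have "norm (fourier f \<xi>) \<le> (LINT x|lebesgue. norm (exp (- (\<i> * of_real (x \<bullet> \<xi>))) * f x))"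
    unfolding fourier_def by (rule integral_norm_bound)
  then show ?thesis by (simp add: L1_norm_def norm_mult)
qed

lemma fourier_diff:
  assumes "integrable lebesgue f" "integrable lebesgue g"
  shows "fourier (\<lambda>x. f x - g x) \<xi> = fourier f \<xi> - fourier g \<xi>"
  unfolding fourier_def using assms[THEN fourier_integrand_integrable]
  by (simp add: right_diff_distrib)

lemma fourier_borel_measurable:
  assumes f: "integrable lebesgue (f :: real^'n \<Rightarrow> complex)"
  shows "fourier f \<in> borel_measurable borel"
proof -
  note [measurable] = borel_measurable_integrable[OF f] borel_measurable_lebesgue_id
  show ?thesis
    unfolding fourier_def by (intro lebesgue.borel_measurable_lebesgue_integral) measurable
qed

lemma fourier_measurable:
  "integrable lebesgue (f :: real^'n \<Rightarrow> complex) \<Longrightarrow> fourier f \<in> borel_measurable lebesgue"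
  by (intro borel_measurable_lebesgueI fourier_borel_measurable)

lemma integrable_fourier_mult:
  assumes f: "integrable lebesgue (f :: real^'n \<Rightarrow> complex)" and h: "integrable lebesgue h"
  shows "integrable lebesgue (\<lambda>\<xi>. fourier f \<xi> * h \<xi>)"
proof (rule Bochner_Integration.integrable_bound)
  show "integrable lebesgue (\<lambda>\<xi>. L1_norm f * norm (h \<xi>))"
    using h by simp
  show "AE \<xi> in lebesgue. norm (fourier f \<xi> * h \<xi>) \<le> norm (L1_norm f * norm (h \<xi>))"
    using norm_fourier_le[of f] by (auto simp: norm_mult intro!: mult_right_mono order_trans[OF _ abs_ge_self] AE_I2)
  show "(\<lambda>\<xi>. fourier f \<xi> * h \<xi>) \<in> borel_measurable lebesgue"
    using fourier_measurable[OF f] h by (intro borel_measurable_times) auto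
qed

text \<open>
  Fubini's theorem for the kernel, which is symmetric in both variables and has modulus 1. Plancherel's
  theorem uses it to evaluate energies, the comparison with the inverse transform to evaluate inner products.
\<close>

lemma fourier_multiplication_formula:
  assumes f: "integrable lebesgue (f :: real^'n \<Rightarrow> complex)" and h: "integrable lebesgue h"
  shows "(LINT \<xi>|lebesgue. fourier f \<xi> * h \<xi>) = (LINT x|lebesgue. f x * fourier h x)"
proof -
  note [measurable] = borel_measurable_integrable[OF f] borel_measurable_integrable[OF h]
    borel_measurable_lebesgue_id
  let ?k = "\<lambda>x \<xi>. exp (- (\<i> * complex_of_real (x \<bullet> \<xi>))) * f x * h \<xi>"
  have int: "integrable (lebesgue \<Otimes>\<^sub>M lebesgue) (case_prod ?k)"
  proof (rule lebesgue_pair.Fubini_integrable)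
    show "case_prod ?k \<in> borel_measurable (lebesgue \<Otimes>\<^sub>M lebesgue)"
      by measurable
    have "(\<lambda>x. LINT \<xi>|lebesgue. norm (case_prod ?k (x, \<xi>))) = (\<lambda>x. norm (f x) * L1_norm h)"
      by (simp add: norm_mult L1_norm_def)
    then show "integrable lebesgue (\<lambda>x. LINT \<xi>|lebesgue. norm (case_prod ?k (x, \<xi>)))"
      using f by simp
    have "integrable lebesgue (\<lambda>\<xi>. f x * (exp (- (\<i> * complex_of_real (\<xi> \<bullet> x))) * h \<xi>))" for x
      by (intro integrable_mult_right fourier_integrand_integrable h)
    then show "AE x in lebesgue. integrable lebesgue (\<lambda>\<xi>. case_prod ?k (x, \<xi>))"
      by (simp add: inner_commute mult_ac)
  qed
  have "(LINT \<xi>|lebesgue. fourier f \<xi> * h \<xi>) = (LINT \<xi>|lebesgue. LINT x|lebesgue. ?k x \<xi>)"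
    by (simp add: fourier_def)
  also have "\<dots> = (LINT x|lebesgue. LINT \<xi>|lebesgue. ?k x \<xi>)"
    by (rule lebesgue_pair.Fubini_integral[OF int])
  also have "\<dots> = (LINT x|lebesgue. LINT \<xi>|lebesgue. f x * (exp (- (\<i> * complex_of_real (\<xi> \<bullet> x))) * h \<xi>))"
    by (simp add: inner_commute mult_ac)
  also have "\<dots> = (LINT x|lebesgue. f x * fourier h x)"
    by (simp add: fourier_def)
  finally show ?thesis .
qed

lemma lborel_integral_prod:
  fixes f :: "'a::euclidean_space \<Rightarrow> real \<Rightarrow> complex"
  assumes int: "\<And>b. b \<in> Basis \<Longrightarrow> integrable lborel (f b)"
  shows "integrable lborel (\<lambda>x. \<Prod>b\<in>Basis. f b (x \<bullet> b))"
    and "(LINT x|lborel. (\<Prod>b\<in>Basis. f b (x \<bullet> b))) = (\<Prod>b\<in>Basis. (LINT x|lborel. f b x))"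
proof -
  interpret product_sigma_finite "\<lambda>_::'a. lborel :: real measure" ..
  have [measurable]: "f b \<in> borel_measurable borel" if "b \<in> Basis" for b
    using borel_measurable_integrable[OF int[OF that]] by simp
  have m: "(\<lambda>x. \<Prod>b\<in>Basis. f b (x \<bullet> b)) \<in> borel_measurable borel"
    by measurable
  have t: "(\<lambda>g. \<Sum>b\<in>Basis. g b *\<^sub>R b) \<in> (\<Pi>\<^sub>M b\<in>(Basis::'a set). lborel) \<rightarrow>\<^sub>M borel"
    by measurable
  have eq: "(\<Prod>b\<in>Basis. f b ((\<Sum>b\<in>Basis. g b *\<^sub>R b) \<bullet> b)) = (\<Prod>b\<in>Basis. f b (g b))" for g
    by (intro prod.cong) auto
  show "integrable lborel (\<lambda>x. \<Prod>b\<in>Basis. f b (x \<bullet> b))"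
    using product_integrable_prod[OF finite_Basis int]
    by (subst lborel_eq, subst integrable_distr_eq[OF t m]) (simp add: eq)
  show "(LINT x|lborel. (\<Prod>b\<in>Basis. f b (x \<bullet> b))) = (\<Prod>b\<in>Basis. (LINT x|lborel. f b x))"
    using product_integral_prod[OF finite_Basis int]
    by (subst lborel_eq, subst integral_distr[OF t m]) (simp add: eq)
qed

section \<open>Gaussians and the heat kernel\<close>

text \<open>
  The characteristic function of the standard normal distribution, rescaled by the factor s.
\<close>

lemma gaussian_fourier_real:
  assumes s: "s > 0"
  shows "integrable lborel (\<lambda>\<xi>. exp (- (\<i> * of_real (\<xi> * x))) * complex_of_real (exp (- (s\<^sup>2 * \<xi>\<^sup>2) / 2)))" (is ?I)
    and "(LINT \<xi>|lborel. exp (- (\<i> * of_real (\<xi> * x))) * complex_of_real (exp (- (s\<^sup>2 * \<xi>\<^sup>2) / 2)))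
      = of_real (sqrt (2 * pi) / s * exp (- x\<^sup>2 / (2 * s\<^sup>2)))" (is ?E)
proof -
  define F where "F y = std_normal_density y *\<^sub>R iexp (- (x / s) * y)" for y
  have int: "integrable lborel F"
  proof (rule Bochner_Integration.integrable_bound[OF integrable_std_normal_moment_abs[of 0]])
    have "continuous_on UNIV F" unfolding F_def std_normal_density_def by (intro continuous_intros) auto
    then show "F \<in> borel_measurable lborel" by (simp add: borel_measurable_continuous_onI)
    show "AE y in lborel. norm (F y) \<le> norm (std_normal_density y * \<bar>y\<bar> ^ 0)"
      by (simp add: F_def norm_exp_i_times)
  qed
  have "char std_normal_distribution (- (x / s)) = (LINT y|lborel. F y)"
    unfolding char_def F_def by (subst integral_density) auto
  then have val: "(LINT y|lborel. F y) = of_real (exp (- (x / s)\<^sup>2 / 2))"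
    by (simp add: char_std_normal_distribution)
  have eq: "exp (- (\<i> * of_real (\<xi> * x))) * complex_of_real (exp (- (s\<^sup>2 * \<xi>\<^sup>2) / 2))
      = of_real (sqrt (2 * pi)) * F (0 + s * \<xi>)" for \<xi>
    using s by (simp add: F_def std_normal_density_def scaleR_conv_of_real mult_ac power_mult_distrib)
  show ?I
    unfolding eq by (intro integrable_mult_right lborel_integrable_real_affine int) (use s in simp)
  have "(LINT \<xi>|lborel. F (0 + s * \<xi>)) = of_real (exp (- (x / s)\<^sup>2 / 2)) /\<^sub>R s"
    using lborel_integral_real_affine[of s F 0] s val by simp
  then show ?E
    unfolding eq using s by (simp add: scaleR_conv_of_real field_simps power_divide)
qed

definition gauss :: "real \<Rightarrow> real ^ 'n \<Rightarrow> complex" where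
  "gauss s \<xi> = of_real (exp (- (s\<^sup>2 * (norm \<xi>)\<^sup>2) / 2))"

text \<open>
  The Fourier transform of the Gaussian \<open>gauss s\<close>. Its total mass is \<open>(2 pi) ^ n\<close> for every s, and it
  concentrates at the origin as s tends to 0.
\<close>

definition heat_kernel :: "real \<Rightarrow> real ^ 'n \<Rightarrow> real" where
  "heat_kernel s x = (sqrt (2 * pi) / s) ^ CARD('n) * exp (- (norm x)\<^sup>2 / (2 * s\<^sup>2))"

text \<open>
  Both the Gaussian and the kernel factor over the coordinates, which reduces the claim to dimension 1.
\<close>

lemma gauss_fourier:
  fixes x :: "real ^ 'n"
  assumes s: "s > 0"
  shows "integrable lebesgue (gauss s :: real^'n \<Rightarrow> complex)"
    and "fourier (gauss s) x = of_real (heat_kernel s x)"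
proof -
  have nrm: "(norm y)\<^sup>2 = (\<Sum>b\<in>Basis. (y \<bullet> b)\<^sup>2)" for y :: "real^'n"
    unfolding power2_norm_eq_inner by (subst euclidean_inner) (simp add: power2_eq_square)
  have eq: "exp (- (\<i> * of_real (\<xi> \<bullet> x))) * gauss s \<xi>
      = (\<Prod>b\<in>Basis. exp (- (\<i> * of_real ((\<xi> \<bullet> b) * (x \<bullet> b)))) * complex_of_real (exp (- (s\<^sup>2 * (\<xi> \<bullet> b)\<^sup>2) / 2)))"
    for \<xi> x :: "real^'n"
    unfolding prod.distrib gauss_def of_real_prod[symmetric]
    by (simp add: euclidean_inner[of \<xi> x] nrm exp_sum[symmetric] sum_negf sum_distrib_left sum_divide_distrib)
  note P = lborel_integral_prod[of "\<lambda>b \<xi>. exp (- (\<i> * of_real (\<xi> * (x \<bullet> b)))) * complex_of_real (exp (- (s\<^sup>2 * \<xi>\<^sup>2) / 2))" for x :: "real^'n",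
      OF gaussian_fourier_real(1)[OF s]]
  have "integrable lborel (\<lambda>\<xi>. exp (- (\<i> * of_real (\<xi> \<bullet> (0::real^'n)))) * gauss s \<xi>)"
    unfolding eq by (rule P(1))
  then show "integrable lebesgue (gauss s :: real^'n \<Rightarrow> complex)"
    by (simp add: integrable_completion)
  have [measurable]: "(gauss s :: real^'n \<Rightarrow> complex) \<in> borel_measurable borel"
    unfolding gauss_def by measurable
  have "fourier (gauss s) x = (LINT \<xi>|lborel. exp (- (\<i> * of_real (\<xi> \<bullet> x))) * gauss s \<xi>)"
    unfolding fourier_def by (rule integral_completion) measurable
  also have "\<dots> = (\<Prod>b\<in>(Basis::(real^'n) set). of_real (sqrt (2 * pi) / s * exp (- (x \<bullet> b)\<^sup>2 / (2 * s\<^sup>2))))"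
    unfolding eq P(2) gaussian_fourier_real(2)[OF s] ..
  also have "\<dots> = of_real (\<Prod>b\<in>(Basis::(real^'n) set). sqrt (2 * pi) / s * exp (- (x \<bullet> b)\<^sup>2 / (2 * s\<^sup>2)))"
    by simp
  also have "\<dots> = of_real (heat_kernel s x)"
    unfolding prod.distrib heat_kernel_def
    by (simp add: nrm exp_sum[symmetric] sum_negf sum_divide_distrib)
  finally show "fourier (gauss s) x = of_real (heat_kernel s x)" .
qed

lemma heat_kernel_pos: "s > 0 \<Longrightarrow> 0 < heat_kernel s x"
  by (simp add: heat_kernel_def)

lemma heat_kernel_nonneg: "s > 0 \<Longrightarrow> 0 \<le> heat_kernel s x"
  by (rule less_imp_le[OF heat_kernel_pos])

lemma heat_kernel_commute: "heat_kernel s (x - y) = heat_kernel s (y - x)"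
  by (simp add: heat_kernel_def norm_minus_commute)

lemma heat_kernel_measurable [measurable]: "heat_kernel s \<in> borel_measurable borel"
  unfolding heat_kernel_def by measurable

lemma lborel_nn_integral_affine:
  fixes a :: "'a::euclidean_space"
  assumes "s > 0" and [measurable]: "f \<in> borel_measurable borel"
  shows "(\<integral>\<^sup>+y. f y \<partial>lborel) = ennreal (s ^ DIM('a)) * (\<integral>\<^sup>+z. f (a + s *\<^sub>R z) \<partial>lborel)"
  using assms(1)
  by (subst lborel_affine[of s a]) (simp_all add: nn_integral_density nn_integral_distr nn_integral_cmult)

lemma lborel_integral_affine:
  fixes a :: "'a::euclidean_space" and f :: "'a \<Rightarrow> complex"
  assumes "s > 0" and [measurable]: "f \<in> borel_measurable borel"
  shows "(LINT y|lborel. f y) = s ^ DIM('a) *\<^sub>R (LINT z|lborel. f (a + s *\<^sub>R z))"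
  using assms(1)
  by (subst lborel_affine[of s a]) (simp_all add: integral_density integral_distr)

lemma gauss_inverse_eq_heat_kernel:
  fixes x :: "real ^ 'n"
  assumes "s > 0"
  shows "of_real (heat_kernel s x) = of_real ((sqrt (2 * pi) / s) ^ CARD('n)) * gauss (1 / s) x"
  using assms by (simp add: heat_kernel_def gauss_def power_divide mult_ac)

text \<open>
  Up to a constant the kernel is again a Gaussian, with parameter \<open>1 / s\<close>, so its mass is the value at 0 of
  the Fourier transform of that Gaussian.
\<close>

lemma heat_kernel_integral:
  assumes s: "s > 0"
  shows "integrable lebesgue (heat_kernel s :: real^'n \<Rightarrow> real)"
    and "(LINT x|lebesgue. heat_kernel s (x :: real^'n)) = (2 * pi) ^ CARD('n)"
proof -
  have s': "1 / s > 0" using s by simp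
  have "integrable lebesgue (\<lambda>x :: real^'n. complex_of_real (heat_kernel s x))"
    unfolding gauss_inverse_eq_heat_kernel[OF s]
    by (intro integrable_mult_right gauss_fourier(1)[OF s'])
  from integrable_Re[OF this] show "integrable lebesgue (heat_kernel s :: real^'n \<Rightarrow> real)"
    by simp
  have "complex_of_real (LINT x|lebesgue. heat_kernel s (x :: real^'n))
      = (LINT x|lebesgue. complex_of_real (heat_kernel s (x :: real^'n)))"
    by simp
  also have "\<dots> = of_real ((sqrt (2 * pi) / s) ^ CARD('n)) * fourier (gauss (1 / s)) (0 :: real^'n)"
    unfolding gauss_inverse_eq_heat_kernel[OF s] by (simp add: fourier_def)
  also have "\<dots> = of_real ((sqrt (2 * pi) / s) ^ CARD('n) * (sqrt (2 * pi) / (1 / s)) ^ CARD('n))"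
    unfolding gauss_fourier(2)[OF s'] by (simp add: heat_kernel_def)
  also have "(sqrt (2 * pi) / s) ^ CARD('n) * (sqrt (2 * pi) / (1 / s)) ^ CARD('n)
      = (2 * pi) ^ CARD('n)"
    unfolding power_mult_distrib[symmetric] using s by simp
  finally show "(LINT x|lebesgue. heat_kernel s (x :: real^'n)) = (2 * pi) ^ CARD('n)"
    by (simp only: of_real_eq_iff)
qed

lemma heat_kernel_nn_integral:
  fixes x :: "real ^ 'n"
  assumes s: "s > 0"
  shows "(\<integral>\<^sup>+y. ennreal (heat_kernel s (y - x)) \<partial>lebesgue) = ennreal ((2 * pi) ^ CARD('n))"
proof -
  have "(\<integral>\<^sup>+y. ennreal (heat_kernel s (y - x)) \<partial>lebesgue) = (\<integral>\<^sup>+y. ennreal (heat_kernel s (y::real^'n)) \<partial>lebesgue)"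
    unfolding nn_integral_completion
    using lborel_nn_integral_affine[of 1 "\<lambda>y. ennreal (heat_kernel s (y - x))" x] by simp
  also have "\<dots> = ennreal ((2 * pi) ^ CARD('n))"
    using heat_kernel_integral[OF s, where 'n='n]
    by (subst nn_integral_eq_integral) (auto simp: heat_kernel_nonneg[OF s])
  finally show ?thesis .
qed

section \<open>Plancherel's theorem\<close>

lemma norm_integral_le_nn_integral:
  fixes f :: "'a \<Rightarrow> 'b::{banach, second_countable_topology}"
  shows "ennreal (norm (integral\<^sup>L M f)) \<le> (\<integral>\<^sup>+x. ennreal (norm (f x)) \<partial>M)"
  by (cases "integrable M f") (auto intro: integral_norm_bound_ennreal simp: not_integrable_integral_eq)

lemma norm_gauss_le_1: "norm (gauss s \<xi>) \<le> 1"
  by (simp add: gauss_def)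

lemma gauss_measurable [measurable]: "gauss s \<in> borel_measurable lebesgue"
  unfolding gauss_def by (intro borel_measurable_lebesgueI) measurable

text \<open>
  The energy of the transform, damped by a Gaussian, is a quadratic form in f with the heat kernel as its
  kernel. The multiplication formula is used twice: to move the transform from f to the conjugate of the
  damped transform, and to evaluate the transform of the latter.
\<close>

lemma gaussian_energy_identity:
  fixes f :: "real ^ 'n \<Rightarrow> complex"
  assumes f: "integrable lebesgue f" and s: "s > 0"
  shows "(LINT \<xi>|lebesgue. gauss s \<xi> * of_real ((norm (fourier f \<xi>))\<^sup>2))
    = (LINT x|lebesgue. f x * cnj (LINT y|lebesgue. f y * of_real (heat_kernel s (y - x))))"
proof -
  note g = gauss_fourier(1)[OF s, where 'n='n]
  note [measurable] = fourier_measurable[OF f]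
  define h where "h \<xi> = cnj (fourier f \<xi> * gauss s \<xi>)" for \<xi>
  have h: "integrable lebesgue h"
    unfolding h_def using integrable_fourier_mult[OF f g] by (rule integrable_cnj)
  have Fh: "fourier h x = cnj (LINT y|lebesgue. f y * of_real (heat_kernel s (y - x)))" for x
  proof -
    \<comment> \<open>The modulated Gaussian, whose transform is the heat kernel translated by x.\<close>
    define e where "e \<xi> = exp (- (\<i> * of_real (\<xi> \<bullet> (- x)))) * gauss s \<xi>" for \<xi>
    have e: "integrable lebesgue e"
      unfolding e_def by (rule fourier_integrand_integrable[OF g])
    have Fe: "fourier e y = of_real (heat_kernel s (y - x))" for y
    proof -
      have "fourier e y = fourier (gauss s) (y - x)"
        unfolding fourier_def e_def
        by (intro Bochner_Integration.integral_cong) (auto simp: inner_diff_right algebra_simps exp_add[symmetric])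
      then show ?thesis by (simp add: gauss_fourier(2)[OF s])
    qed
    have "fourier h x = (LINT \<xi>|lebesgue. cnj (fourier f \<xi> * e \<xi>))"
      unfolding fourier_def[of h] h_def e_def
      by (intro Bochner_Integration.integral_cong) (auto simp: exp_cnj gauss_def mult_ac)
    also have "\<dots> = cnj (LINT \<xi>|lebesgue. fourier f \<xi> * e \<xi>)"
      by (rule Bochner_Integration.integral_cnj)
    also have "(LINT \<xi>|lebesgue. fourier f \<xi> * e \<xi>) = (LINT y|lebesgue. f y * of_real (heat_kernel s (y - x)))"
      by (simp add: fourier_multiplication_formula[OF f e] Fe)
    finally show ?thesis .
  qed
  have "gauss s \<xi> * of_real ((norm (fourier f \<xi>))\<^sup>2) = fourier f \<xi> * h \<xi>" for \<xi>
    unfolding complex_norm_square h_def by (simp add: gauss_def)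
  then have "(LINT \<xi>|lebesgue. gauss s \<xi> * of_real ((norm (fourier f \<xi>))\<^sup>2)) = (LINT \<xi>|lebesgue. fourier f \<xi> * h \<xi>)"
    by simp
  also have "\<dots> = (LINT x|lebesgue. f x * fourier h x)"
    by (rule fourier_multiplication_formula[OF f h])
  finally show ?thesis by (simp add: Fh)
qed

text \<open>
  Schur's test: after the inequality of arithmetic and geometric means each of the two summands contains f
  at one point only, and integrating the kernel in the other variable gives its mass.
\<close>

lemma heat_kernel_quadratic_form_le:
  fixes f :: "real ^ 'n \<Rightarrow> complex"
  assumes f: "in_L2 f" and s: "s > 0"
  shows "(\<integral>\<^sup>+x. \<integral>\<^sup>+y. ennreal (norm (f x) * norm (f y) * heat_kernel s (y - x)) \<partial>lebesgue \<partial>lebesgue)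
    \<le> ennreal ((2 * pi) ^ CARD('n) * (L2_norm f)\<^sup>2)"
proof -
  note [measurable] = in_L2_measurable[OF f] borel_measurable_lebesgue_id
  let ?k = "\<lambda>x y. heat_kernel s (y - x)" and ?q = "\<lambda>x. (norm (f x))\<^sup>2"
  note k0 = heat_kernel_nonneg[OF s]
  have am_gm: "a * b * c \<le> (a\<^sup>2 * c + b\<^sup>2 * c) / 2" if "c \<ge> 0" for a b c :: real
    using mult_right_mono[OF sum_squares_bound[of a b] that] by (simp add: algebra_simps)
  have pointwise: "ennreal (norm (f x) * norm (f y) * ?k x y)
      \<le> ennreal (?q x * ?k x y / 2) + ennreal (?q y * ?k x y / 2)" for x y
  proof -
    have "norm (f x) * norm (f y) * ?k x y \<le> ?q x * ?k x y / 2 + ?q y * ?k x y / 2"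
      using am_gm[OF k0, of "norm (f x)" "norm (f y)" "y - x"] by (simp add: add_divide_distrib)
    then have "ennreal (norm (f x) * norm (f y) * ?k x y) \<le> ennreal (?q x * ?k x y / 2 + ?q y * ?k x y / 2)"
      by (rule ennreal_leI)
    also have "\<dots> = ennreal (?q x * ?k x y / 2) + ennreal (?q y * ?k x y / 2)"
      by (rule ennreal_plus) (simp_all add: k0)
    finally show ?thesis .
  qed
  have half: "(\<integral>\<^sup>+x. \<integral>\<^sup>+y. ennreal (?q x * ?k x y / 2) \<partial>lebesgue \<partial>lebesgue)
      = ennreal ((2 * pi) ^ CARD('n) * (L2_norm f)\<^sup>2 / 2)"
  proof -
    have "(\<integral>\<^sup>+y. ennreal (?q x * ?k x y / 2) \<partial>lebesgue) = ennreal ((2 * pi) ^ CARD('n) / 2) * ennreal (?q x)" for x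
    proof -
      have "(\<integral>\<^sup>+y. ennreal (?q x * ?k x y / 2) \<partial>lebesgue) = (\<integral>\<^sup>+y. ennreal (?q x / 2) * ennreal (?k x y) \<partial>lebesgue)"
        by (intro nn_integral_cong) (simp add: ennreal_mult[symmetric] k0)
      also have "\<dots> = ennreal (?q x / 2) * ennreal ((2 * pi) ^ CARD('n))"
        by (subst nn_integral_cmult) (measurable, simp add: heat_kernel_nn_integral[OF s])
      finally show ?thesis by (simp add: ennreal_mult[symmetric] mult_ac)
    qed
    then have "(\<integral>\<^sup>+x. \<integral>\<^sup>+y. ennreal (?q x * ?k x y / 2) \<partial>lebesgue \<partial>lebesgue)
        = (\<integral>\<^sup>+x. ennreal ((2 * pi) ^ CARD('n) / 2) * ennreal (?q x) \<partial>lebesgue)"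
      by (intro nn_integral_cong)
    also have "\<dots> = ennreal ((2 * pi) ^ CARD('n) / 2) * ennreal ((L2_norm f)\<^sup>2)"
      by (subst nn_integral_cmult) (measurable, simp add: nn_integral_L2_norm[OF f])
    finally show ?thesis by (simp add: ennreal_mult[symmetric])
  qed
  have "(\<integral>\<^sup>+x. \<integral>\<^sup>+y. ennreal (norm (f x) * norm (f y) * ?k x y) \<partial>lebesgue \<partial>lebesgue)
      \<le> (\<integral>\<^sup>+x. \<integral>\<^sup>+y. ennreal (?q x * ?k x y / 2) + ennreal (?q y * ?k x y / 2) \<partial>lebesgue \<partial>lebesgue)"
    by (intro nn_integral_mono pointwise)
  also have "\<dots> = (\<integral>\<^sup>+x. \<integral>\<^sup>+y. ennreal (?q x * ?k x y / 2) \<partial>lebesgue \<partial>lebesgue)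
      + (\<integral>\<^sup>+x. \<integral>\<^sup>+y. ennreal (?q y * ?k x y / 2) \<partial>lebesgue \<partial>lebesgue)"
    by (subst nn_integral_add[symmetric], measurable, intro nn_integral_cong nn_integral_add) measurable
  also have "(\<integral>\<^sup>+x. \<integral>\<^sup>+y. ennreal (?q y * ?k x y / 2) \<partial>lebesgue \<partial>lebesgue)
      = (\<integral>\<^sup>+y. \<integral>\<^sup>+x. ennreal (?q y * ?k x y / 2) \<partial>lebesgue \<partial>lebesgue)"
    by (rule lebesgue_pair.Fubini') measurable
  also have "\<dots> = (\<integral>\<^sup>+x. \<integral>\<^sup>+y. ennreal (?q x * ?k x y / 2) \<partial>lebesgue \<partial>lebesgue)"
    by (simp add: heat_kernel_commute)
  also note half
  finally show ?thesis by (simp add: ennreal_plus[symmetric] mult_ac del: ennreal_plus)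
qed

lemma gaussian_energy_le:
  fixes f :: "real ^ 'n \<Rightarrow> complex"
  assumes f: "integrable lebesgue f" and f2: "in_L2 f" and s: "s > 0"
  shows "(\<integral>\<^sup>+\<xi>. ennreal (exp (- (s\<^sup>2 * (norm \<xi>)\<^sup>2) / 2) * (norm (fourier f \<xi>))\<^sup>2) \<partial>lebesgue)
    \<le> ennreal ((2 * pi) ^ CARD('n) * (L2_norm f)\<^sup>2)"
proof -
  note [measurable] = in_L2_measurable[OF f2] borel_measurable_lebesgue_id fourier_measurable[OF f]
  note g = gauss_fourier(1)[OF s, where 'n='n]
  let ?e = "\<lambda>\<xi>::real^'n. exp (- (s\<^sup>2 * (norm \<xi>)\<^sup>2) / 2) * (norm (fourier f \<xi>))\<^sup>2"
  have eq: "complex_of_real (?e \<xi>) = gauss s \<xi> * of_real ((norm (fourier f \<xi>))\<^sup>2)" for \<xi>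
    by (simp add: gauss_def)
  have "integrable lebesgue (\<lambda>\<xi>. fourier f \<xi> * (fourier f \<xi> * gauss s \<xi>))"
    by (intro integrable_fourier_mult f g)
  then have "integrable lebesgue (\<lambda>\<xi>. norm (fourier f \<xi> * (fourier f \<xi> * gauss s \<xi>)))"
    by (rule integrable_norm)
  then have int: "integrable lebesgue ?e"
    by (simp add: norm_mult gauss_def power2_eq_square mult_ac)
  have "ennreal (LINT \<xi>|lebesgue. ?e \<xi>)
      = ennreal (norm (LINT \<xi>|lebesgue. complex_of_real (?e \<xi>)))"
    by (subst integral_complex_of_real, subst norm_of_real) (simp add: abs_of_nonneg integral_nonneg)
  also have "\<dots> = ennreal (norm (LINT x|lebesgue. f x * cnj (LINT y|lebesgue. f y * of_real (heat_kernel s (y - x)))))"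
    unfolding eq gaussian_energy_identity[OF f s] ..
  also have "\<dots> \<le> (\<integral>\<^sup>+x. ennreal (norm (f x * cnj (LINT y|lebesgue. f y * of_real (heat_kernel s (y - x))))) \<partial>lebesgue)"
    by (rule norm_integral_le_nn_integral)
  also have "\<dots> \<le> (\<integral>\<^sup>+x. \<integral>\<^sup>+y. ennreal (norm (f x) * norm (f y) * heat_kernel s (y - x)) \<partial>lebesgue \<partial>lebesgue)"
  proof (rule nn_integral_mono)
    fix x
    have "ennreal (norm (LINT y|lebesgue. f y * complex_of_real (heat_kernel s (y - x))))
        \<le> (\<integral>\<^sup>+y. ennreal (norm (f y * complex_of_real (heat_kernel s (y - x)))) \<partial>lebesgue)"
      by (rule norm_integral_le_nn_integral)
    then have "ennreal (norm (f x * cnj (LINT y|lebesgue. f y * of_real (heat_kernel s (y - x)))))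
       \<le> ennreal (norm (f x)) * (\<integral>\<^sup>+y. ennreal (norm (f y * complex_of_real (heat_kernel s (y - x)))) \<partial>lebesgue)"
      by (simp add: norm_mult ennreal_mult mult_left_mono)
    also have "\<dots> = (\<integral>\<^sup>+y. ennreal (norm (f x) * norm (f y) * heat_kernel s (y - x)) \<partial>lebesgue)"
      by (subst nn_integral_cmult[symmetric])
         (auto simp: norm_mult ennreal_mult[symmetric] heat_kernel_nonneg[OF s] mult_ac)
    finally show "ennreal (norm (f x * cnj (LINT y|lebesgue. f y * of_real (heat_kernel s (y - x)))))
      \<le> (\<integral>\<^sup>+y. ennreal (norm (f x) * norm (f y) * heat_kernel s (y - x)) \<partial>lebesgue)" .
  qed
  also note heat_kernel_quadratic_form_le[OF f2 s]
  finally show ?thesis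
    using int by (subst nn_integral_eq_integral) auto
qed

lemma inverse_Suc_tendsto_0: "(\<lambda>k. 1 / real (Suc k)) \<longlonglongrightarrow> 0"
  using LIMSEQ_inverse_real_of_nat by (simp add: inverse_eq_divide)

lemma gauss_tendsto_1: "(\<lambda>k. exp (- ((1 / real (Suc k))\<^sup>2 * a) / 2)) \<longlonglongrightarrow> 1"
proof -
  have "(\<lambda>k. exp (- ((1 / real (Suc k))\<^sup>2 * a) / 2)) \<longlonglongrightarrow> exp (- (0\<^sup>2 * a) / 2)"
    by (intro tendsto_intros inverse_Suc_tendsto_0) simp
  then show ?thesis by simp
qed

text \<open>
  One half of Plancherel's theorem: the damped energies are bounded uniformly in the damping, and Fatou's
  lemma removes the damping.
\<close>

lemma fourier_L2_bound:
  fixes f :: "real ^ 'n \<Rightarrow> complex"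
  assumes f: "integrable lebesgue f" and f2: "in_L2 f"
  shows "in_L2 (fourier f)" and "(L2_norm (fourier f))\<^sup>2 \<le> (2 * pi) ^ CARD('n) * (L2_norm f)\<^sup>2"
proof -
  note [measurable] = fourier_measurable[OF f] borel_measurable_lebesgue_id
  let ?u = "\<lambda>k \<xi>::real^'n. ennreal (exp (- ((1 / real (Suc k))\<^sup>2 * (norm \<xi>)\<^sup>2) / 2) * (norm (fourier f \<xi>))\<^sup>2)"
  let ?B = "ennreal ((2 * pi) ^ CARD('n) * (L2_norm f)\<^sup>2)"
  have lim: "liminf (\<lambda>k. ?u k \<xi>) = ennreal ((norm (fourier f \<xi>))\<^sup>2)" for \<xi>
  proof (rule lim_imp_Liminf)
    have "(\<lambda>k. ?u k \<xi>) \<longlonglongrightarrow> ennreal (1 * (norm (fourier f \<xi>))\<^sup>2)"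
      by (intro tendsto_ennrealI tendsto_mult tendsto_const gauss_tendsto_1)
    then show "(\<lambda>k. ?u k \<xi>) \<longlonglongrightarrow> ennreal ((norm (fourier f \<xi>))\<^sup>2)" by simp
  qed simp
  have "(\<integral>\<^sup>+\<xi>. ennreal ((norm (fourier f \<xi>))\<^sup>2) \<partial>lebesgue) = (\<integral>\<^sup>+\<xi>. liminf (\<lambda>k. ?u k \<xi>) \<partial>lebesgue)"
    unfolding lim ..
  also have "\<dots> \<le> liminf (\<lambda>k. \<integral>\<^sup>+\<xi>. ?u k \<xi> \<partial>lebesgue)"
    by (rule nn_integral_liminf) measurable
  also have "\<dots> \<le> liminf (\<lambda>k. ?B)"
    by (intro Liminf_mono always_eventually allI gaussian_energy_le f f2) simp
  also have "\<dots> = ?B"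
    by (rule Liminf_const) simp
  finally have le: "(\<integral>\<^sup>+\<xi>. ennreal ((norm (fourier f \<xi>))\<^sup>2) \<partial>lebesgue) \<le> ?B" .
  then have "(\<integral>\<^sup>+\<xi>. ennreal ((norm (fourier f \<xi>))\<^sup>2) \<partial>lebesgue) < \<infinity>"
    by (rule order_le_less_trans) simp
  then show "in_L2 (fourier f)"
    using fourier_measurable[OF f] by (simp add: in_L2_iff_nn_integral)
  from le show "(L2_norm (fourier f))\<^sup>2 \<le> (2 * pi) ^ CARD('n) * (L2_norm f)\<^sup>2"
    unfolding nn_integral_L2_norm[OF \<open>in_L2 (fourier f)\<close>] by simp
qed

lemma heat_kernel_rescale:
  fixes z :: "real ^ 'n"
  assumes "s > 0"
  shows "s ^ CARD('n) * heat_kernel s (s *\<^sub>R z) = heat_kernel 1 z"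
  using assms by (simp add: heat_kernel_def power_mult_distrib power_divide)

text \<open>
  The substitution \<open>y = x + s z\<close> turns the kernel with parameter s into the fixed kernel with parameter 1,
  after which continuity of g at x and dominated convergence give the limit.
\<close>

lemma heat_kernel_approximate_identity:
  fixes g :: "real ^ 'n \<Rightarrow> complex"
  assumes g: "continuous_compact_support g" and B: "\<And>x. norm (g x) \<le> B"
  shows "(\<lambda>k. LINT y|lebesgue. g y * of_real (heat_kernel (1 / real (Suc k)) (y - x)))
     \<longlonglongrightarrow> of_real ((2 * pi) ^ CARD('n)) * g x"
    and "norm (LINT y|lebesgue. g y * of_real (heat_kernel (1 / real (Suc k)) (y - x)))
     \<le> B * (2 * pi) ^ CARD('n)"
proof -
  have cont: "continuous_on UNIV g"
    using g by (simp add: continuous_compact_support_def)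
  have [measurable]: "g \<in> borel_measurable borel"
    using cont by (rule borel_measurable_continuous_onI)
  have eq: "(LINT y|lebesgue. g y * of_real (heat_kernel (1 / real (Suc k)) (y - x)))
      = (LINT z|lborel. of_real (heat_kernel 1 z) * g (x + (1 / real (Suc k)) *\<^sub>R z))" for k
  proof -
    let ?s = "1 / real (Suc k)"
    have "(LINT y|lebesgue. g y * of_real (heat_kernel ?s (y - x))) = (LINT y|lborel. g y * of_real (heat_kernel ?s (y - x)))"
      by (rule integral_completion) measurable
    also have "\<dots> = ?s ^ DIM(real^'n) *\<^sub>R (LINT z|lborel. g (x + ?s *\<^sub>R z) * of_real (heat_kernel ?s (x + ?s *\<^sub>R z - x)))"
      by (rule lborel_integral_affine) (simp, measurable)
    also have "\<dots> = (LINT z|lborel. of_real (?s ^ CARD('n) * heat_kernel ?s (?s *\<^sub>R z)) * g (x + ?s *\<^sub>R z))"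
      by (subst Bochner_Integration.integral_scaleR_right[symmetric])
         (auto simp: scaleR_conv_of_real mult_ac intro!: Bochner_Integration.integral_cong)
    also have "\<dots> = (LINT z|lborel. of_real (heat_kernel 1 z) * g (x + ?s *\<^sub>R z))"
      by (subst heat_kernel_rescale) simp_all
    finally show ?thesis .
  qed
  have hk: "integrable lborel (heat_kernel 1 :: real^'n \<Rightarrow> real)"
    and hkv: "(LINT z|lborel. heat_kernel 1 (z::real^'n)) = (2 * pi) ^ CARD('n)"
    using heat_kernel_integral[where s=1 and 'n='n] by (simp_all add: integrable_completion integral_completion)
  have "(\<lambda>k. LINT z|lborel. of_real (heat_kernel 1 z) * g (x + (1 / real (Suc k)) *\<^sub>R z))
      \<longlonglongrightarrow> (LINT z|lborel. of_real (heat_kernel 1 (z::real^'n)) * g x)"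
  proof (rule integral_dominated_convergence[where w = "\<lambda>z. heat_kernel 1 z * B"])
    show "AE z in lborel. (\<lambda>k. complex_of_real (heat_kernel 1 z) * g (x + (1 / real (Suc k)) *\<^sub>R z))
        \<longlonglongrightarrow> complex_of_real (heat_kernel 1 z) * g x"
    proof (intro AE_I2 tendsto_mult tendsto_const)
      fix z
      have "(\<lambda>k. x + (1 / real (Suc k)) *\<^sub>R z) \<longlonglongrightarrow> x + 0 *\<^sub>R z"
        by (intro tendsto_intros inverse_Suc_tendsto_0)
      moreover have "isCont g x"
        using cont by (simp add: continuous_on_eq_continuous_at)
      ultimately show "(\<lambda>k. g (x + (1 / real (Suc k)) *\<^sub>R z)) \<longlonglongrightarrow> g x"
        by (intro isCont_tendsto_compose[of x g]) simp_all
    qed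
    show "integrable lborel (\<lambda>z::real^'n. heat_kernel 1 z * B)"
      using hk by simp
    show "AE z in lborel. norm (complex_of_real (heat_kernel 1 z) * g (x + (1 / real (Suc k)) *\<^sub>R z)) \<le> heat_kernel 1 z * B" for k
      using B by (intro AE_I2) (auto simp: norm_mult heat_kernel_nonneg intro!: mult_mono)
  qed measurable
  also have "(LINT z|lborel. of_real (heat_kernel 1 (z::real^'n)) * g x) = of_real (LINT z|lborel. heat_kernel 1 (z::real^'n)) * g x"
    using hk by simp
  finally show "(\<lambda>k. LINT y|lebesgue. g y * of_real (heat_kernel (1 / real (Suc k)) (y - x)))
     \<longlonglongrightarrow> of_real ((2 * pi) ^ CARD('n)) * g x"
    unfolding eq hkv .
  have "norm (LINT z|lborel. of_real (heat_kernel 1 z) * g (x + (1 / real (Suc k)) *\<^sub>R z))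
      \<le> (LINT z|lborel. norm (of_real (heat_kernel 1 z) * g (x + (1 / real (Suc k)) *\<^sub>R z)))"
    by (rule integral_norm_bound)
  also have "\<dots> \<le> (LINT z|lborel. heat_kernel 1 (z::real^'n) * B)"
    using B hk order_trans[OF norm_ge_zero B] by (intro integral_mono') (auto simp: norm_mult heat_kernel_nonneg intro!: mult_mono)
  also have "\<dots> = B * (2 * pi) ^ CARD('n)"
    using hk hkv by simp
  finally show "norm (LINT y|lebesgue. g y * of_real (heat_kernel (1 / real (Suc k)) (y - x)))
     \<le> B * (2 * pi) ^ CARD('n)"
    unfolding eq .
qed

text \<open>
  For a continuous function with compact support both sides of the energy identity converge as the damping
  is removed: the left-hand side is dominated thanks to \<open>fourier_L2_bound\<close>, the right-hand side by a
  multiple of the function itself.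
\<close>

lemma plancherel_continuous:
  fixes g :: "real ^ 'n \<Rightarrow> complex"
  assumes g: "continuous_compact_support g"
  shows "(L2_norm (fourier g))\<^sup>2 = (2 * pi) ^ CARD('n) * (L2_norm g)\<^sup>2"
proof -
  note gi = continuous_compact_support_integrable[OF g]
  note G = fourier_L2_bound(1)[OF gi]
  obtain B where B: "B > 0" "\<And>x. norm (g x) \<le> B"
    using continuous_compact_support_bounded[OF g] by blast
  note [measurable] = fourier_measurable[OF gi(1)] borel_measurable_lebesgue_id in_L2_measurable[OF gi(2)]
  let ?s = "\<lambda>k. 1 / real (Suc k)"
  let ?I = "\<lambda>k x. LINT y|lebesgue. g y * of_real (heat_kernel (?s k) (y - x))"
  have [measurable]: "cnj \<in> borel_measurable borel"
    by (intro borel_measurable_continuous_onI continuous_intros)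
  have I_meas [measurable]: "?I k \<in> borel_measurable lebesgue" for k
    by (rule lebesgue.borel_measurable_lebesgue_integral) measurable
  have "(\<lambda>k. LINT \<xi>|lebesgue. gauss (?s k) \<xi> * of_real ((norm (fourier g \<xi>))\<^sup>2))
      \<longlonglongrightarrow> (LINT \<xi>|lebesgue. complex_of_real ((norm (fourier g \<xi>))\<^sup>2))"
  proof (rule integral_dominated_convergence[OF _ _ in_L2_integrable[OF G]])
    have "(\<lambda>k. gauss (?s k) \<xi> * complex_of_real ((norm (fourier g \<xi>))\<^sup>2))
        \<longlonglongrightarrow> of_real 1 * complex_of_real ((norm (fourier g \<xi>))\<^sup>2)" for \<xi>
      unfolding gauss_def by (intro tendsto_mult tendsto_const tendsto_of_real gauss_tendsto_1)
    then show "AE \<xi> in lebesgue. (\<lambda>k. gauss (?s k) \<xi> * complex_of_real ((norm (fourier g \<xi>))\<^sup>2))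
        \<longlonglongrightarrow> complex_of_real ((norm (fourier g \<xi>))\<^sup>2)"
      by simp
    show "AE \<xi> in lebesgue. norm (gauss (?s k) \<xi> * complex_of_real ((norm (fourier g \<xi>))\<^sup>2)) \<le> (norm (fourier g \<xi>))\<^sup>2" for k
      using mult_right_mono[OF norm_gauss_le_1, of "(norm (fourier g _))\<^sup>2"]
      by (intro AE_I2) (simp add: norm_mult norm_power)
  qed measurable
  also have "(\<lambda>k. LINT \<xi>|lebesgue. gauss (?s k) \<xi> * of_real ((norm (fourier g \<xi>))\<^sup>2))
      = (\<lambda>k. LINT x|lebesgue. g x * cnj (?I k x))"
    by (intro ext gaussian_energy_identity gi) simp
  finally have lim1: "(\<lambda>k. LINT x|lebesgue. g x * cnj (?I k x))
      \<longlonglongrightarrow> (LINT \<xi>|lebesgue. complex_of_real ((norm (fourier g \<xi>))\<^sup>2))" .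
  have lim2: "(\<lambda>k. LINT x|lebesgue. g x * cnj (?I k x))
      \<longlonglongrightarrow> (LINT x|lebesgue. g x * cnj (of_real ((2 * pi) ^ CARD('n)) * g x))"
  proof (rule integral_dominated_convergence[where w = "\<lambda>x. norm (g x) * (B * (2 * pi) ^ CARD('n))"])
    show "integrable lebesgue (\<lambda>x. norm (g x) * (B * (2 * pi) ^ CARD('n)))"
      using gi by simp
    show "AE x in lebesgue. (\<lambda>k. g x * cnj (?I k x)) \<longlonglongrightarrow> g x * cnj (of_real ((2 * pi) ^ CARD('n)) * g x)"
      by (intro AE_I2 tendsto_mult tendsto_const tendsto_cnj heat_kernel_approximate_identity(1)[OF g B(2)])
    show "AE x in lebesgue. norm (g x * cnj (?I k x)) \<le> norm (g x) * (B * (2 * pi) ^ CARD('n))" for k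
      unfolding norm_mult complex_mod_cnj
      by (intro AE_I2 mult_left_mono norm_ge_zero heat_kernel_approximate_identity(2)[OF g B(2)])
  qed measurable
  have cn: "g x * cnj (of_real ((2 * pi) ^ CARD('n)) * g x) = of_real ((2 * pi) ^ CARD('n) * (norm (g x))\<^sup>2)" for x
    unfolding of_real_mult complex_norm_square by simp
  have "(LINT \<xi>|lebesgue. complex_of_real ((norm (fourier g \<xi>))\<^sup>2))
      = (LINT x|lebesgue. complex_of_real ((2 * pi) ^ CARD('n) * (norm (g x))\<^sup>2))"
    by (rule LIMSEQ_unique[OF lim1 lim2[unfolded cn]])
  then have "(LINT \<xi>|lebesgue. (norm (fourier g \<xi>))\<^sup>2) = (LINT x|lebesgue. (2 * pi) ^ CARD('n) * (norm (g x))\<^sup>2)"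
    unfolding integral_complex_of_real of_real_eq_iff .
  then show ?thesis by (simp add: L2_norm_power2)
qed

text \<open>
  The upper bound makes the transform continuous in the norm, so the equality extends from the dense
  subspace of continuous functions with compact support.
\<close>

lemma plancherel:
  fixes f :: "real ^ 'n \<Rightarrow> complex"
  assumes f: "integrable lebesgue f" and f2: "in_L2 f"
  shows "in_L2 (fourier f)" and "L2_norm (fourier f) = sqrt ((2 * pi) ^ CARD('n)) * L2_norm f"
proof -
  let ?c = "sqrt ((2 * pi) ^ CARD('n)) :: real"
  have le: "L2_norm (fourier h) \<le> ?c * L2_norm h" if "integrable lebesgue h" "in_L2 h" for h :: "real^'n \<Rightarrow> complex"
    using real_sqrt_le_mono[OF fourier_L2_bound(2)[OF that]] by (simp add: real_sqrt_mult)
  show F: "in_L2 (fourier f)" by (rule fourier_L2_bound(1)[OF f f2])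
  have "?c * L2_norm f \<le> L2_norm (fourier f) + e" if e: "e > 0" for e
  proof -
    have c: "?c > 0" by simp
    obtain g where g: "continuous_compact_support g" and ge: "L2_norm (\<lambda>x. g x - f x) < e / (2 * ?c)"
      using continuous_compact_support_dense[OF f2, of "e / (2 * ?c)"] e c by auto
    note gi = continuous_compact_support_integrable[OF g]
    have ig: "integrable lebesgue (\<lambda>x. g x - f x)" "in_L2 (\<lambda>x. g x - f x)"
      using gi f f2 by (auto intro: in_L2_diff)
    have G: "L2_norm (fourier g) = ?c * L2_norm g"
      using arg_cong[OF plancherel_continuous[OF g], of sqrt] by (simp add: real_sqrt_mult)
    have fg: "fourier (\<lambda>x. g x - f x) = (\<lambda>\<xi>. fourier g \<xi> - fourier f \<xi>)"
      using fourier_diff[OF gi(1) f] by auto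
    have d: "?c * L2_norm (\<lambda>x. g x - f x) \<le> e / 2"
      using ge c by (simp add: field_simps)
    have "L2_norm f \<le> L2_norm (\<lambda>x. f x - g x) + L2_norm g"
      using L2_norm_triangle[OF in_L2_diff[OF f2 gi(2)] gi(2)] by simp
    then have "?c * L2_norm f \<le> ?c * L2_norm (\<lambda>x. g x - f x) + L2_norm (fourier g)"
      unfolding G distrib_left[symmetric] using c
      by (simp add: L2_norm_minus_commute[of g f] del: real_sqrt_gt_0_iff)
    also have "L2_norm (fourier g) \<le> L2_norm (fourier (\<lambda>x. g x - f x)) + L2_norm (fourier f)"
      unfolding fg using L2_norm_triangle[OF in_L2_diff[OF fourier_L2_bound(1)[OF gi] F] F] by simp
    also have "L2_norm (fourier (\<lambda>x. g x - f x)) \<le> ?c * L2_norm (\<lambda>x. g x - f x)"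
      by (rule le[OF ig])
    finally show ?thesis using d by linarith
  qed
  then have "?c * L2_norm f \<le> L2_norm (fourier f)"
    by (rule field_le_epsilon)
  with le[OF f f2] show "L2_norm (fourier f) = ?c * L2_norm f"
    by simp
qed

section \<open>The Fourier transform of square-integrable functions\<close>

lemma in_L2_cnj: "in_L2 f \<Longrightarrow> in_L2 (\<lambda>x. cnj (f x))"
proof -
  assume f: "in_L2 f"
  note [measurable] = in_L2_measurable[OF f]
  have [measurable]: "cnj \<in> borel_measurable borel"
    by (intro borel_measurable_continuous_onI continuous_intros)
  have "(\<lambda>x. cnj (f x)) \<in> borel_measurable lebesgue" by measurable
  then show ?thesis using f by (simp add: in_L2_def)
qed

lemma L2_norm_cnj: "L2_norm (\<lambda>x. cnj (f x)) = L2_norm f"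
  by (simp add: L2_norm_def)

lemma L2_norm_diff_power2:
  assumes f: "in_L2 f" and g: "in_L2 g"
  shows "(L2_norm (\<lambda>x. f x - g x))\<^sup>2 = (L2_norm f)\<^sup>2 + (L2_norm g)\<^sup>2 - 2 * Re (LINT x|lebesgue. f x * cnj (g x))"
proof -
  note fg = integrable_mult_L2[OF f in_L2_cnj[OF g]]
  have "(norm (a - b))\<^sup>2 = (norm a)\<^sup>2 + (norm b)\<^sup>2 - 2 * Re (a * cnj b)" for a b :: complex
    by (simp add: cmod_power2) (simp add: power2_eq_square algebra_simps)
  then have "(L2_norm (\<lambda>x. f x - g x))\<^sup>2
      = (LINT x|lebesgue. (norm (f x))\<^sup>2 + (norm (g x))\<^sup>2 - 2 * Re (f x * cnj (g x)))"
    by (simp add: L2_norm_power2)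
  also have "\<dots> = (LINT x|lebesgue. (norm (f x))\<^sup>2) + (LINT x|lebesgue. (norm (g x))\<^sup>2)
      - (LINT x|lebesgue. 2 * Re (f x * cnj (g x)))"
    by (simp only: Bochner_Integration.integral_diff Bochner_Integration.integral_add
        Bochner_Integration.integrable_add in_L2_integrable[OF f] in_L2_integrable[OF g]
        integrable_mult_right integrable_Re[OF fg])
  also have "(LINT x|lebesgue. 2 * Re (f x * cnj (g x))) = 2 * Re (LINT x|lebesgue. f x * cnj (g x))"
    by (simp only: integral_mult_right_zero integral_Re[OF fg])
  finally show ?thesis by (simp add: L2_norm_power2)
qed

abbreviation ball_cut :: "real \<Rightarrow> (real ^ 'n \<Rightarrow> complex) \<Rightarrow> real ^ 'n \<Rightarrow> complex" where
  "ball_cut R f \<equiv> (\<lambda>x. indicat_real (ball 0 R) x *\<^sub>R f x)"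

lemma ball_cut_measurable:
  "f \<in> borel_measurable lebesgue \<Longrightarrow> ball_cut R f \<in> borel_measurable lebesgue"
  by (intro borel_measurable_scaleR borel_measurable_indicator) auto

lemma in_L2_ball_cut:
  assumes "in_L2 f"
  shows "in_L2 (ball_cut R f)"
  by (rule in_L2_AE_le[OF assms ball_cut_measurable[OF in_L2_measurable[OF assms]], of _ 1])
     (simp add: indicator_def)

text \<open>
  Square-integrable functions are locally integrable: the cut-off is a product with the indicator of a
  bounded set.
\<close>

lemma integrable_ball_cut:
  fixes f :: "real ^ 'n \<Rightarrow> complex"
  assumes "in_L2 f"
  shows "integrable lebesgue (ball_cut R f)"
proof -
  let ?i = "\<lambda>x::real^'n. complex_of_real (indicat_real (ball 0 R) x)"
  have [measurable]: "ball (0::real^'n) R \<in> sets borel" by simp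
  have m: "?i \<in> borel_measurable lebesgue"
    by (intro borel_measurable_lebesgueI) measurable
  have m2: "(\<lambda>x. (norm (?i x))\<^sup>2) \<in> borel_measurable lebesgue"
    using m by measurable
  have "integrable lebesgue (\<lambda>x. (norm (?i x))\<^sup>2)"
    by (rule integrable_bounded_support[OF m2, of 1 R]) (auto simp: indicator_def)
  then have "in_L2 ?i"
    using m by (simp add: in_L2_def)
  from integrable_mult_L2[OF this assms] show ?thesis
    by (simp add: scaleR_conv_of_real)
qed

lemma ball_cut_tendsto:
  fixes f :: "real ^ 'n \<Rightarrow> complex"
  assumes f: "in_L2 f"
  shows "((\<lambda>R. L2_norm (\<lambda>x. ball_cut R f x - f x)) \<longlongrightarrow> 0) at_top"
proof -
  note [measurable] = in_L2_measurable[OF f] ball_cut_measurable[OF in_L2_measurable[OF f]]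
  have "((\<lambda>R. LINT x|lebesgue. (norm (ball_cut R f x - f x))\<^sup>2) \<longlongrightarrow> (LINT x|(lebesgue :: (real^'n) measure). 0)) at_top"
  proof (rule integral_dominated_convergence_at_top[where w="\<lambda>x. (norm (f x))\<^sup>2"])
    show "integrable lebesgue (\<lambda>x. (norm (f x))\<^sup>2)"
      by (rule in_L2_integrable[OF f])
    show "\<forall>\<^sub>F R in at_top. AE x in lebesgue. norm ((norm (ball_cut R f x - f x))\<^sup>2) \<le> (norm (f x))\<^sup>2"
      by (intro always_eventually allI AE_I2) (auto simp: indicator_def)
    have "((\<lambda>R. (norm (ball_cut R f x - f x))\<^sup>2) \<longlongrightarrow> 0) at_top" for x
    proof (rule tendsto_eventually)
      show "\<forall>\<^sub>F R in at_top. (norm (ball_cut R f x - f x))\<^sup>2 = 0"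
        using eventually_gt_at_top[of "norm x"] by eventually_elim (simp add: indicator_def)
    qed
    then show "AE x in lebesgue. ((\<lambda>R. (norm (ball_cut R f x - f x))\<^sup>2) \<longlongrightarrow> 0) at_top"
      by simp
  qed measurable
  from tendsto_real_sqrt[OF this] show ?thesis
    by (simp add: L2_norm_def)
qed

lemma fourier_ball_cut_diff:
  fixes f :: "real ^ 'n \<Rightarrow> complex"
  assumes "in_L2 f"
  shows "L2_norm (\<lambda>\<xi>. fourier (ball_cut R f) \<xi> - fourier (ball_cut R' f) \<xi>)
    = sqrt ((2 * pi) ^ CARD('n)) * L2_norm (\<lambda>x. ball_cut R f x - ball_cut R' f x)"
  unfolding fourier_diff[OF integrable_ball_cut[OF assms] integrable_ball_cut[OF assms], symmetric]
  by (intro plancherel Bochner_Integration.integrable_diff integrable_ball_cut in_L2_diff in_L2_ball_cut assms)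

text \<open>
  The limit in mean that defines \<open>L2_fourier\<close> exists: by Plancherel the transforms of the cut-offs are as
  close to each other as the cut-offs themselves.
\<close>

lemma L2_fourier_limit:
  fixes f :: "real ^ 'n \<Rightarrow> complex"
  assumes f: "in_L2 f"
  shows "in_L2 (L2_fourier f)"
    and "((\<lambda>R. L2_norm (\<lambda>\<xi>. fourier (ball_cut R f) \<xi> - L2_fourier f \<xi>)) \<longlongrightarrow> 0) at_top"
proof -
  let ?c = "sqrt ((2 * pi) ^ CARD('n)) :: real"
  have c: "?c > 0" by simp
  note cut = in_L2_ball_cut[OF f]
  have "\<exists>g. in_L2 g \<and> ((\<lambda>R. L2_norm (\<lambda>\<xi>. fourier (ball_cut R f) \<xi> - g \<xi>)) \<longlongrightarrow> 0) at_top"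
  proof (rule L2_complete_at_top)
    show "in_L2 (fourier (ball_cut R f))" for R
      by (rule plancherel(1)[OF integrable_ball_cut[OF f] cut])
    fix e :: real assume e: "e > 0"
    have "\<forall>\<^sub>F R in at_top. L2_norm (\<lambda>x. ball_cut R f x - f x) < e / (2 * ?c)"
      using e c by (intro order_tendstoD(2)[OF ball_cut_tendsto[OF f]]) simp
    then obtain r where r: "\<And>R. R \<ge> r \<Longrightarrow> L2_norm (\<lambda>x. ball_cut R f x - f x) < e / (2 * ?c)"
      by (auto simp: eventually_at_top_linorder)
    have "L2_norm (\<lambda>\<xi>. fourier (ball_cut R f) \<xi> - fourier (ball_cut R' f) \<xi>) \<le> e"
      if "R \<ge> r" "R' \<ge> r" for R R'
    proof -
      have "L2_norm (\<lambda>x. ball_cut R f x - ball_cut R' f x)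
          \<le> L2_norm (\<lambda>x. ball_cut R f x - f x) + L2_norm (\<lambda>x. f x - ball_cut R' f x)"
        by (intro L2_norm_triangle_diff cut f)
      also have "\<dots> \<le> e / (2 * ?c) + e / (2 * ?c)"
        using r[OF that(1)] r[OF that(2)] by (simp only: L2_norm_minus_commute[of f])
      also have "\<dots> = e / ?c" by simp
      finally show ?thesis
        unfolding fourier_ball_cut_diff[OF f] using c by (simp only: pos_le_divide_eq mult.commute)
    qed
    then show "\<exists>r. \<forall>R\<ge>r. \<forall>R'\<ge>r. L2_norm (\<lambda>\<xi>. fourier (ball_cut R f) \<xi> - fourier (ball_cut R' f) \<xi>) \<le> e"
      by blast
  qed
  from someI_ex[OF this]
  show "in_L2 (L2_fourier f)"
    and "((\<lambda>R. L2_norm (\<lambda>\<xi>. fourier (ball_cut R f) \<xi> - L2_fourier f \<xi>)) \<longlongrightarrow> 0) at_top"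
    unfolding L2_fourier_def by blast+
qed

text \<open>
  Both functions are limits in mean of the same family, so their distance is 0.
\<close>

lemma L2_fourier_eq_fourier:
  fixes f :: "real ^ 'n \<Rightarrow> complex"
  assumes f: "integrable lebesgue f" and f2: "in_L2 f"
  shows "AE \<xi> in lebesgue. L2_fourier f \<xi> = fourier f \<xi>"
proof -
  let ?c = "sqrt ((2 * pi) ^ CARD('n)) :: real"
  let ?F = "\<lambda>R. fourier (ball_cut R f)"
  note F = plancherel(1)[OF f f2] and G = L2_fourier_limit[OF f2]
  note cut = integrable_ball_cut[OF f2] in_L2_ball_cut[OF f2]
  have FR: "in_L2 (?F R)" for R by (rule plancherel(1)[OF cut])
  have diff: "L2_norm (\<lambda>\<xi>. ?F R \<xi> - fourier f \<xi>) = ?c * L2_norm (\<lambda>x. ball_cut R f x - f x)" for R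
    unfolding fourier_diff[OF cut(1) f, symmetric]
    by (intro plancherel Bochner_Integration.integrable_diff in_L2_diff cut f f2)
  have "((\<lambda>R. ?c * L2_norm (\<lambda>x. ball_cut R f x - f x) + L2_norm (\<lambda>\<xi>. ?F R \<xi> - L2_fourier f \<xi>)) \<longlongrightarrow> ?c * 0 + 0) at_top"
    by (intro tendsto_intros ball_cut_tendsto f2 G)
  moreover have "\<forall>\<^sub>F R in at_top. L2_norm (\<lambda>\<xi>. L2_fourier f \<xi> - fourier f \<xi>)
      \<le> ?c * L2_norm (\<lambda>x. ball_cut R f x - f x) + L2_norm (\<lambda>\<xi>. ?F R \<xi> - L2_fourier f \<xi>)"
  proof (intro always_eventually allI)
    fix R
    show "L2_norm (\<lambda>\<xi>. L2_fourier f \<xi> - fourier f \<xi>)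
      \<le> ?c * L2_norm (\<lambda>x. ball_cut R f x - f x) + L2_norm (\<lambda>\<xi>. ?F R \<xi> - L2_fourier f \<xi>)"
      using L2_norm_triangle_diff[OF G(1) FR[of R] F] diff[of R]
      by (simp add: L2_norm_minus_commute[of "L2_fourier f"])
  qed
  ultimately have "L2_norm (\<lambda>\<xi>. L2_fourier f \<xi> - fourier f \<xi>) \<le> ?c * 0 + 0"
    by (rule tendsto_lowerbound) simp
  then have "L2_norm (\<lambda>\<xi>. L2_fourier f \<xi> - fourier f \<xi>) = 0"
    using L2_norm_nonneg[of "\<lambda>\<xi>. L2_fourier f \<xi> - fourier f \<xi>"] by linarith
  from L2_norm_eq_0_imp_AE[OF in_L2_diff[OF G(1) F] this] show ?thesis
    by simp
qed

text \<open>
  Conjugation carries every statement about the transform over to its inverse.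
\<close>

lemma inv_fourier_eq_cnj_fourier:
  fixes g :: "real ^ 'n \<Rightarrow> complex"
  shows "inv_fourier g x = of_real (1 / (2 * pi) ^ CARD('n)) * cnj (fourier (\<lambda>\<xi>. cnj (g \<xi>)) x)"
  unfolding inv_fourier_def fourier_def Bochner_Integration.integral_cnj[symmetric]
  by (simp add: exp_cnj inner_commute)

lemma Re_complex_mult_of_real: "Re (complex_of_real (1 / c) * z) = Re z / c"
  by simp

lemma inv_fourier_L2:
  fixes g :: "real ^ 'n \<Rightarrow> complex"
  assumes g: "integrable lebesgue g" and g2: "in_L2 g"
  shows "in_L2 (inv_fourier g)"
    and "(L2_norm (inv_fourier g))\<^sup>2 = (L2_norm g)\<^sup>2 / (2 * pi) ^ CARD('n)"
proof -
  have eq: "inv_fourier g = (\<lambda>x. of_real (1 / (2 * pi) ^ CARD('n)) * cnj (fourier (\<lambda>\<xi>. cnj (g \<xi>)) x))"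
    by (rule ext) (rule inv_fourier_eq_cnj_fourier)
  note P = plancherel[OF integrable_cnj[OF g] in_L2_cnj[OF g2]]
  show "in_L2 (inv_fourier g)"
    unfolding eq by (intro in_L2_cmult in_L2_cnj P)
  show "(L2_norm (inv_fourier g))\<^sup>2 = (L2_norm g)\<^sup>2 / (2 * pi) ^ CARD('n)"
    unfolding eq L2_norm_cmult L2_norm_cnj P(2)
    by (simp add: power_mult_distrib norm_divide norm_power norm_mult power_divide) (simp add: power2_eq_square)
qed

text \<open>
  The form in which Fourier inversion enters the argument. Expanding both squares, the norms are
  matched by Plancherel's theorem for f and for g, and the inner products by the multiplication formula.
\<close>

lemma L2_norm_diff_inv_fourier:
  fixes f g :: "real ^ 'n \<Rightarrow> complex"
  assumes f: "integrable lebesgue f" "in_L2 f" and g: "integrable lebesgue g" "in_L2 g"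
  shows "L2_norm (\<lambda>x. f x - inv_fourier g x) = L2_norm (\<lambda>\<xi>. fourier f \<xi> - g \<xi>) / sqrt ((2 * pi) ^ CARD('n))"
proof -
  let ?C = "(2 * pi) ^ CARD('n) :: real"
  have C: "?C > 0" by simp
  have "(LINT x|lebesgue. f x * cnj (inv_fourier g x))
      = (LINT x|lebesgue. of_real (1 / ?C) * (f x * fourier (\<lambda>\<xi>. cnj (g \<xi>)) x))"
    unfolding inv_fourier_eq_cnj_fourier by (intro Bochner_Integration.integral_cong) simp_all
  also have "\<dots> = of_real (1 / ?C) * (LINT x|lebesgue. f x * fourier (\<lambda>\<xi>. cnj (g \<xi>)) x)"
    by (rule integral_mult_right_zero)
  also have "(LINT x|lebesgue. f x * fourier (\<lambda>\<xi>. cnj (g \<xi>)) x) = (LINT \<xi>|lebesgue. fourier f \<xi> * cnj (g \<xi>))"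
    by (rule fourier_multiplication_formula[OF f(1) integrable_cnj[OF g(1)], symmetric])
  finally have inner: "Re (LINT x|lebesgue. f x * cnj (inv_fourier g x))
      = Re (LINT \<xi>|lebesgue. fourier f \<xi> * cnj (g \<xi>)) / ?C"
    by (simp only: Re_complex_mult_of_real)
  have "(L2_norm (\<lambda>x. f x - inv_fourier g x))\<^sup>2
      = (L2_norm f)\<^sup>2 + (L2_norm g)\<^sup>2 / ?C - 2 * (Re (LINT \<xi>|lebesgue. fourier f \<xi> * cnj (g \<xi>)) / ?C)"
    unfolding L2_norm_diff_power2[OF f(2) inv_fourier_L2(1)[OF g]] inv_fourier_L2(2)[OF g] inner ..
  also have "(L2_norm f)\<^sup>2 = (L2_norm (fourier f))\<^sup>2 / ?C"
    unfolding plancherel(2)[OF f] by (simp add: power_mult_distrib)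
  also have "(L2_norm (fourier f))\<^sup>2 / ?C + (L2_norm g)\<^sup>2 / ?C - 2 * (Re (LINT \<xi>|lebesgue. fourier f \<xi> * cnj (g \<xi>)) / ?C)
      = (L2_norm (\<lambda>\<xi>. fourier f \<xi> - g \<xi>))\<^sup>2 / ?C"
    unfolding L2_norm_diff_power2[OF plancherel(1)[OF f] g(2)]
    by (simp only: add_divide_distrib diff_divide_distrib times_divide_eq_right)
  finally have "sqrt ((L2_norm (\<lambda>x. f x - inv_fourier g x))\<^sup>2) = sqrt ((L2_norm (\<lambda>\<xi>. fourier f \<xi> - g \<xi>))\<^sup>2 / ?C)"
    by simp
  then show ?thesis
    by (simp only: real_sqrt_divide real_sqrt_abs abs_of_nonneg[OF L2_norm_nonneg])
qed

text \<open>
  The extension to functions u that need not be integrable, by cutting u off to balls and letting the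
  radius tend to infinity.
\<close>

lemma L2_norm_diff_inv_fourier_le:
  fixes u g :: "real ^ 'n \<Rightarrow> complex"
  assumes u: "in_L2 u" and g: "integrable lebesgue g" "in_L2 g"
  shows "L2_norm (\<lambda>x. u x - inv_fourier g x) \<le> L2_norm (\<lambda>\<xi>. L2_fourier u \<xi> - g \<xi>) / sqrt ((2 * pi) ^ CARD('n))"
proof -
  let ?c = "sqrt ((2 * pi) ^ CARD('n)) :: real"
  let ?F = "\<lambda>R. fourier (ball_cut R u)"
  have c: "?c > 0" by simp
  note G = L2_fourier_limit[OF u] and v = inv_fourier_L2(1)[OF g]
  note cut = integrable_ball_cut[OF u] in_L2_ball_cut[OF u]
  let ?bound = "\<lambda>R. L2_norm (\<lambda>x. ball_cut R u x - u x)
      + (L2_norm (\<lambda>\<xi>. ?F R \<xi> - L2_fourier u \<xi>) + L2_norm (\<lambda>\<xi>. L2_fourier u \<xi> - g \<xi>)) / ?c"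
  have "(?bound \<longlongrightarrow> 0 + (0 + L2_norm (\<lambda>\<xi>. L2_fourier u \<xi> - g \<xi>)) / ?c) at_top"
    using c by (intro tendsto_intros ball_cut_tendsto u G) auto
  moreover have "\<forall>\<^sub>F R in at_top. L2_norm (\<lambda>x. u x - inv_fourier g x) \<le> ?bound R"
  proof (intro always_eventually allI)
    fix R
    have "L2_norm (\<lambda>x. u x - inv_fourier g x)
        \<le> L2_norm (\<lambda>x. u x - ball_cut R u x) + L2_norm (\<lambda>x. ball_cut R u x - inv_fourier g x)"
      by (intro L2_norm_triangle_diff u cut v)
    also have "L2_norm (\<lambda>x. u x - ball_cut R u x) = L2_norm (\<lambda>x. ball_cut R u x - u x)"
      by (rule L2_norm_minus_commute)
    also have "L2_norm (\<lambda>x. ball_cut R u x - inv_fourier g x) = L2_norm (\<lambda>\<xi>. ?F R \<xi> - g \<xi>) / ?c"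
      by (rule L2_norm_diff_inv_fourier[OF cut g])
    also have "\<dots> \<le> (L2_norm (\<lambda>\<xi>. ?F R \<xi> - L2_fourier u \<xi>) + L2_norm (\<lambda>\<xi>. L2_fourier u \<xi> - g \<xi>)) / ?c"
      using c by (intro divide_right_mono L2_norm_triangle_diff plancherel(1) cut G g) auto
    finally show "L2_norm (\<lambda>x. u x - inv_fourier g x) \<le> ?bound R" by simp
  qed
  ultimately have "L2_norm (\<lambda>x. u x - inv_fourier g x) \<le> 0 + (0 + L2_norm (\<lambda>\<xi>. L2_fourier u \<xi> - g \<xi>)) / ?c"
    by (rule tendsto_lowerbound) simp
  then show ?thesis by simp
qed

section \<open>The damped oscillator at a fixed frequency\<close>

lemma linear_ode_solution:
  fixes z :: "real \<Rightarrow> complex"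
  assumes z: "\<And>t. t \<ge> 0 \<Longrightarrow> (z has_vector_derivative c * z t) (at t within {0..})" and t: "t \<ge> 0"
  shows "z t = exp (t *\<^sub>R c) * z 0"
proof -
  \<comment> \<open>The integrating factor makes the product constant.\<close>
  have "((\<lambda>s. exp (s *\<^sub>R (- c)) * z s) has_vector_derivative 0) (at s within {0..})" if "s \<in> {0..}" for s
  proof -
    have "((\<lambda>s. exp (s *\<^sub>R (- c)) * z s) has_vector_derivative
        exp (s *\<^sub>R (- c)) * (c * z s) + exp (s *\<^sub>R (- c)) * (- c) * z s) (at s within {0..})"
      using that by (intro has_vector_derivative_mult exp_scaleR_has_vector_derivative_right z) simp
    then show ?thesis by (simp add: algebra_simps)
  qed
  then obtain C where C: "\<And>s. s \<in> {0..} \<Longrightarrow> exp (s *\<^sub>R (- c)) * z s = C"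
    using has_vector_derivative_zero_constant[of "{0::real..}" "\<lambda>s. exp (s *\<^sub>R (- c)) * z s"] by auto
  have "exp (t *\<^sub>R (- c)) * z t = z 0"
    using C[of t] C[of 0] t by simp
  then have "exp (t *\<^sub>R c) * (exp (t *\<^sub>R (- c)) * z t) = exp (t *\<^sub>R c) * z 0"
    by simp
  then show ?thesis
    by (simp add: mult.assoc[symmetric] exp_add[symmetric])
qed

text \<open>
  The characteristic roots are \<open>- a + \<i> b\<close> and \<open>- a - \<i> b\<close>. For each of them, \<open>w'\<close> minus that root times w
  solves a first order equation with the other root; subtracting the two explicit solutions isolates w.
\<close>

lemma damped_oscillator_solution:
  fixes w w' :: "real \<Rightarrow> complex" and a b :: real
  assumes w: "\<And>t. t \<ge> 0 \<Longrightarrow> (w has_vector_derivative w' t) (at t within {0..})"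
    and w': "\<And>t. t \<ge> 0 \<Longrightarrow> (w' has_vector_derivative
        - (of_real (2 * a) * w' t) - of_real (a\<^sup>2 + b\<^sup>2) * w t) (at t within {0..})"
    and b: "b \<noteq> 0" and t: "t \<ge> 0"
  shows "w t = of_real (exp (- a * t))
     * (of_real (cos (b * t)) * w 0 + of_real (sin (b * t) / b) * (w' 0 + of_real a * w 0))"
proof -
  \<comment> \<open>The two choices \<open>c = b\<close> and \<open>c = - b\<close> are the two characteristic roots.\<close>
  have factor: "w' t + (of_real a + \<i> * of_real c) * w t
      = exp (t *\<^sub>R (- of_real a + \<i> * of_real c)) * (w' 0 + (of_real a + \<i> * of_real c) * w 0)"
    if c: "c\<^sup>2 = b\<^sup>2" for c
  proof (rule linear_ode_solution[where z="\<lambda>t. w' t + (of_real a + \<i> * of_real c) * w t", OF _ t])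
    fix s :: real assume s: "0 \<le> s"
    have "((\<lambda>t. w' t + (of_real a + \<i> * of_real c) * w t) has_vector_derivative
        (- (of_real (2 * a) * w' s) - of_real (a\<^sup>2 + c\<^sup>2) * w s) + (of_real a + \<i> * of_real c) * w' s) (at s within {0..})"
      unfolding c by (intro has_vector_derivative_add has_vector_derivative_mult_right w w' s)
    moreover have "(- (of_real (2 * a) * w' s) - of_real (a\<^sup>2 + c\<^sup>2) * w s) + (of_real a + \<i> * of_real c) * w' s
        = (- of_real a + \<i> * of_real c) * (w' s + (of_real a + \<i> * of_real c) * w s)"
      by (simp add: algebra_simps power2_eq_square)
    ultimately show "((\<lambda>t. w' t + (of_real a + \<i> * of_real c) * w t) has_vector_derivative
        (- of_real a + \<i> * of_real c) * (w' s + (of_real a + \<i> * of_real c) * w s)) (at s within {0..})"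
      by simp
  qed
  have ex: "exp (t *\<^sub>R (- of_real a + \<i> * of_real c)) = of_real (exp (- a * t)) * (of_real (cos (c * t)) + \<i> * of_real (sin (c * t)))"
    for c :: real
  proof -
    have "t *\<^sub>R (- of_real a + \<i> * of_real c) = of_real (- a * t) + \<i> * complex_of_real (c * t)"
      by (simp add: scaleR_conv_of_real algebra_simps)
    then show ?thesis
      by (simp only: exp_add exp_of_real cis_conv_exp[symmetric]) (simp add: cis.ctr Complex_eq)
  qed
  define E where "E = complex_of_real (exp (- a * t))"
  have p: "w' t + (of_real a + \<i> * of_real b) * w t
      = E * (of_real (cos (b * t)) + \<i> * of_real (sin (b * t))) * (w' 0 + (of_real a + \<i> * of_real b) * w 0)"
    using factor[of b] unfolding ex E_def by simp
  have m: "w' t + (of_real a - \<i> * of_real b) * w t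
      = E * (of_real (cos (b * t)) - \<i> * of_real (sin (b * t))) * (w' 0 + (of_real a - \<i> * of_real b) * w 0)"
    using factor[of "- b"] unfolding ex E_def by simp
  have "2 * \<i> * of_real b * w t = (w' t + (of_real a + \<i> * of_real b) * w t) - (w' t + (of_real a - \<i> * of_real b) * w t)"
    by (simp add: algebra_simps)
  also have "\<dots> = 2 * \<i> * (E * (of_real b * of_real (cos (b * t)) * w 0 + of_real (sin (b * t)) * (w' 0 + of_real a * w 0)))"
    unfolding p m by (simp add: algebra_simps)
  finally have "of_real b * w t = E * (of_real b * of_real (cos (b * t)) * w 0 + of_real (sin (b * t)) * (w' 0 + of_real a * w 0))"
    by simp
  then show ?thesis
    using b unfolding E_def[symmetric] by (simp add: field_simps)
qed

lemma abs_sin_divide_le: "b > 0 \<Longrightarrow> t \<ge> 0 \<Longrightarrow> \<bar>sin (b * t) / b\<bar> \<le> (t::real)"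
  using abs_sin_x_le_abs_x[of "b * t"] by (simp add: abs_mult divide_simps mult.commute)

section \<open>Decay of the low-frequency weight\<close>

text \<open>
  Bernoulli's inequality for real exponents: the difference of the logarithms vanishes at 0 and increases.
\<close>

lemma Bernoulli_powr:
  fixes p r :: real
  assumes p: "p \<ge> 1" and r: "r \<ge> 0"
  shows "1 + p * r \<le> (1 + r) powr p"
proof -
  let ?\<phi> = "\<lambda>x. p * ln (1 + x) - ln (1 + p * x)"
  have "?\<phi> 0 \<le> ?\<phi> r"
  proof (rule DERIV_nonneg_imp_nondecreasing[OF r])
    fix x :: real assume x: "0 \<le> x" "x \<le> r"
    have px: "1 + p * x > 0" using p x by (intro add_pos_nonneg) auto
    have le: "x \<le> p * x" using p x by (simp add: mult_le_cancel_right1)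
    have "(?\<phi> has_real_derivative p / (1 + x) - p / (1 + p * x)) (at x)"
      using x px by (auto intro!: derivative_eq_intros)
    moreover have "p / (1 + p * x) \<le> p / (1 + x)"
      using p x le by (intro divide_left_mono) auto
    ultimately show "\<exists>y. (?\<phi> has_real_derivative y) (at x) \<and> 0 \<le> y"
      by (intro exI[of _ "p / (1 + x) - p / (1 + p * x)"]) simp
  qed
  then have "ln (1 + p * r) \<le> p * ln (1 + r)" by simp
  moreover have "1 + p * r > 0" using p r by (intro add_pos_nonneg) auto
  ultimately have "1 + p * r \<le> exp (p * ln (1 + r))"
    by (metis exp_le_cancel_iff exp_ln)
  then show ?thesis using r by (simp add: powr_def)
qed

text \<open>
  The bound for the difference between a solution and the profile at a frequency, for data of size 1.
\<close>

definition decay_weight :: "real \<Rightarrow> real ^ 'n \<Rightarrow> real" where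
  "decay_weight t \<xi> = (1 + norm \<xi>) powr (- t) * (1 + t * norm \<xi>)"

lemma decay_weight_nonneg: "t \<ge> 0 \<Longrightarrow> 0 \<le> decay_weight t \<xi>"
  by (simp add: decay_weight_def)

text \<open>
  With \<open>y = 1 + t * norm \<xi>\<close>, Bernoulli's inequality bounds the damping factor by \<open>(N / y) ^ N\<close>. One power of y
  is spent on the factor y of the weight. The remaining n powers, squared, dominate a product of one
  factor per coordinate, whose integral is explicit.
\<close>

lemma decay_weight_pointwise_bound:
  fixes \<xi> :: "real ^ 'n"
  defines "N \<equiv> CARD('n) + 1"
  assumes t: "t \<ge> real N"
  shows "(decay_weight t \<xi>)\<^sup>2
    \<le> (real N ^ N)\<^sup>2 * (\<Prod>b\<in>Basis. inverse (1 + (t * (\<xi> \<bullet> b))\<^sup>2))"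
proof -
  define r where "r = norm \<xi>"
  have r: "r \<ge> 0" by (simp add: r_def)
  have N: "real N \<ge> 1" by (simp add: N_def)
  have t0: "t \<ge> 0" "t > 0" using t N by linarith+
  define y where "y = 1 + t * r"
  have y: "y \<ge> 1" using t0 r by (simp add: y_def)
  have "y / real N \<le> 1 + (t / real N) * r"
    using N by (simp add: y_def field_simps)
  also have "\<dots> \<le> (1 + r) powr (t / real N)"
    using t N r by (intro Bernoulli_powr) (simp_all add: divide_simps)
  finally have "(y / real N) ^ N \<le> ((1 + r) powr (t / real N)) ^ N"
    using y by (intro power_mono) auto
  also have "\<dots> = (1 + r) powr t"
    using r N by (simp add: powr_realpow[symmetric] powr_powr)
  finally have "(y / real N) ^ N \<le> (1 + r) powr t" .
  moreover have "(y / real N) ^ N > 0" using y N by simp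
  ultimately have "inverse ((1 + r) powr t) \<le> inverse ((y / real N) ^ N)"
    by (rule le_imp_inverse_le)
  then have "(1 + r) powr (- t) \<le> real N ^ N / y ^ N"
    by (simp only: powr_minus power_divide inverse_divide)
  then have "(1 + r) powr (- t) * y \<le> real N ^ N / y ^ N * y"
    using y by (intro mult_right_mono) auto
  also have "\<dots> = real N ^ N * inverse (y ^ CARD('n))"
    using y by (simp add: N_def field_simps)
  finally have "((1 + r) powr (- t) * y)\<^sup>2 \<le> (real N ^ N * inverse (y ^ CARD('n)))\<^sup>2"
    using y by (intro power_mono) auto
  also have "\<dots> = (real N ^ N)\<^sup>2 * (\<Prod>b\<in>(Basis :: (real^'n) set). inverse (y\<^sup>2))"
    by (simp add: power_mult_distrib power_inverse mult.commute flip: power_mult)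
  also have "\<dots> \<le> (real N ^ N)\<^sup>2 * (\<Prod>b\<in>Basis. inverse (1 + (t * (\<xi> \<bullet> b))\<^sup>2))"
  proof (intro mult_left_mono prod_mono conjI)
    fix b :: "real^'n" assume b: "b \<in> Basis"
    have "(t * (\<xi> \<bullet> b))\<^sup>2 = (t * \<bar>\<xi> \<bullet> b\<bar>)\<^sup>2"
      by (simp add: power_mult_distrib)
    also have "\<dots> \<le> (t * r)\<^sup>2"
      unfolding r_def using Basis_le_norm[OF b, of \<xi>] t0 by (intro power_mono mult_left_mono) auto
    also have "1 + (t * r)\<^sup>2 \<le> y\<^sup>2"
      using t0 r by (simp add: y_def power2_sum)
    finally show "inverse (y\<^sup>2) \<le> inverse (1 + (t * (\<xi> \<bullet> b))\<^sup>2)"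
      by (intro le_imp_inverse_le) (auto simp: add_pos_nonneg)
  qed (use y in auto)
  finally show ?thesis by (simp add: decay_weight_def r_def y_def)
qed

lemma nn_integral_inverse_1_plus_square: "(\<integral>\<^sup>+x. ennreal (inverse (1 + x\<^sup>2)) \<partial>lborel) = ennreal pi"
proof -
  have "integrable lborel (\<lambda>x::real. inverse (1 + x\<^sup>2))"
    using integrable_inverse_1_plus_square by (simp add: set_integrable_def)
  moreover have "(LINT x|lborel. inverse (1 + x\<^sup>2)) = pi"
    using LBINT_inverse_1_plus_square
    by (simp add: interval_lebesgue_integral_def set_lebesgue_integral_def)
  moreover have "0 \<le> inverse (1 + x\<^sup>2)" for x :: real
    by (simp add: add_nonneg_nonneg)
  ultimately show ?thesis
    by (simp add: nn_integral_eq_integral)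
qed

text \<open>
  The integral of the product is a power of \<open>\<integral> 1 / (1 + (t x)\<^sup>2) dx = pi / t\<close>, which is the source of the rate.
\<close>

lemma decay_weight_nn_integral_le:
  defines "N \<equiv> CARD('n) + 1"
  assumes t: "t \<ge> real N"
  shows "(\<integral>\<^sup>+\<xi>. ennreal ((decay_weight t \<xi>)\<^sup>2) \<partial>(lebesgue :: (real ^ 'n) measure))
    \<le> ennreal ((real N ^ N)\<^sup>2 * (pi / t) ^ CARD('n))"
proof -
  have t0: "t > 0" using t by (simp add: N_def)
  have one: "(\<integral>\<^sup>+x. ennreal (inverse (1 + (t * x)\<^sup>2)) \<partial>lborel) = ennreal (pi / t)"
  proof -
    have "ennreal pi = ennreal t * (\<integral>\<^sup>+x. ennreal (inverse (1 + (t * x)\<^sup>2)) \<partial>lborel)"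
      using nn_integral_real_affine[of "\<lambda>x. ennreal (inverse (1 + x\<^sup>2))" t 0] t0
      by (simp add: nn_integral_inverse_1_plus_square)
    then have "ennreal (1 / t) * ennreal pi = ennreal (1 / t) * ennreal t * (\<integral>\<^sup>+x. ennreal (inverse (1 + (t * x)\<^sup>2)) \<partial>lborel)"
      by (simp add: mult.assoc)
    then show ?thesis using t0 by (simp add: ennreal_mult[symmetric])
  qed
  have "(\<integral>\<^sup>+\<xi>. ennreal ((decay_weight t \<xi>)\<^sup>2) \<partial>(lebesgue :: (real ^ 'n) measure))
      \<le> (\<integral>\<^sup>+\<xi>. ennreal ((real N ^ N)\<^sup>2) * ennreal (\<Prod>b\<in>Basis. inverse (1 + (t * (\<xi> \<bullet> b))\<^sup>2)) \<partial>(lebesgue :: (real ^ 'n) measure))"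
  proof (rule nn_integral_mono)
    fix \<xi> :: "real^'n"
    have "0 \<le> (\<Prod>b\<in>Basis. inverse (1 + (t * (\<xi> \<bullet> b))\<^sup>2))"
      by (intro prod_nonneg) (simp add: add_nonneg_nonneg)
    then show "ennreal ((decay_weight t \<xi>)\<^sup>2)
        \<le> ennreal ((real N ^ N)\<^sup>2) * ennreal (\<Prod>b\<in>Basis. inverse (1 + (t * (\<xi> \<bullet> b))\<^sup>2))"
      using decay_weight_pointwise_bound[of t \<xi>] t unfolding N_def
      by (subst ennreal_mult[symmetric]) (auto intro: ennreal_leI)
  qed
  also have "\<dots> = ennreal ((real N ^ N)\<^sup>2) * (\<integral>\<^sup>+\<xi>. ennreal (\<Prod>b\<in>Basis. inverse (1 + (t * (\<xi> \<bullet> b))\<^sup>2)) \<partial>(lborel :: (real ^ 'n) measure))"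
    unfolding nn_integral_completion by (rule nn_integral_cmult) measurable
  also have "(\<integral>\<^sup>+\<xi>. ennreal (\<Prod>b\<in>Basis. inverse (1 + (t * (\<xi> \<bullet> b))\<^sup>2)) \<partial>(lborel :: (real ^ 'n) measure))
      = (\<integral>\<^sup>+\<xi>. (\<Prod>b\<in>Basis. ennreal (inverse (1 + (t * (\<xi> \<bullet> b))\<^sup>2))) \<partial>(lborel :: (real ^ 'n) measure))"
    by (intro nn_integral_cong prod_ennreal[symmetric]) (simp add: add_nonneg_nonneg)
  also have "\<dots> = (\<Prod>b\<in>(Basis :: (real^'n) set). ennreal (pi / t))"
    unfolding one[symmetric] by (rule nn_integral_lborel_prod) simp_all
  also have "\<dots> = ennreal ((pi / t) ^ CARD('n))"
    using t0 by (simp add: ennreal_power)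
  finally show ?thesis
    using t0 by (simp add: ennreal_mult[symmetric] add_nonneg_nonneg)
qed

lemma decay_weight_L2:
  fixes t :: real
  assumes t: "t \<ge> real (CARD('n) + 1)"
  shows "in_L2 (\<lambda>\<xi>::real^'n. complex_of_real (decay_weight t \<xi>))"
    and "L2_norm (\<lambda>\<xi>::real^'n. complex_of_real (decay_weight t \<xi>))
      \<le> real (CARD('n) + 1) ^ (CARD('n) + 1) * sqrt ((pi / t) ^ CARD('n))"
proof -
  let ?N = "CARD('n) + 1"
  have t0: "t > 0" using t by simp
  have m: "(\<lambda>\<xi>::real^'n. complex_of_real (decay_weight t \<xi>)) \<in> borel_measurable lebesgue"
    unfolding decay_weight_def by (intro borel_measurable_lebesgueI) measurable
  have le: "(\<integral>\<^sup>+\<xi>. ennreal ((norm (complex_of_real (decay_weight t \<xi>)))\<^sup>2) \<partial>(lebesgue :: (real^'n) measure))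
      \<le> ennreal ((real ?N ^ ?N)\<^sup>2 * (pi / t) ^ CARD('n))"
    using decay_weight_nn_integral_le[OF t] by (simp only: norm_of_real power2_abs)
  then have "(\<integral>\<^sup>+\<xi>. ennreal ((norm (complex_of_real (decay_weight t \<xi>)))\<^sup>2) \<partial>(lebesgue :: (real^'n) measure)) < \<infinity>"
    by (rule order_le_less_trans) simp
  then show L2: "in_L2 (\<lambda>\<xi>::real^'n. complex_of_real (decay_weight t \<xi>))"
    using m by (simp add: in_L2_iff_nn_integral)
  have "0 \<le> (real ?N ^ ?N)\<^sup>2 * (pi / t) ^ CARD('n)"
    using t0 by simp
  then have "(L2_norm (\<lambda>\<xi>::real^'n. complex_of_real (decay_weight t \<xi>)))\<^sup>2 \<le> (real ?N ^ ?N)\<^sup>2 * (pi / t) ^ CARD('n)"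
    using le unfolding nn_integral_L2_norm[OF L2] by (simp only: ennreal_le_iff)
  then have "L2_norm (\<lambda>\<xi>::real^'n. complex_of_real (decay_weight t \<xi>)) \<le> sqrt ((real ?N ^ ?N)\<^sup>2 * (pi / t) ^ CARD('n))"
    by (rule real_le_rsqrt)
  then show "L2_norm (\<lambda>\<xi>::real^'n. complex_of_real (decay_weight t \<xi>)) \<le> real ?N ^ ?N * sqrt ((pi / t) ^ CARD('n))"
    by (simp only: real_sqrt_mult real_sqrt_abs abs_of_nonneg[OF zero_le_power[OF of_nat_0_le_iff]])
qed

section \<open>Comparison with the asymptotic profile\<close>

text \<open>
  The phase factor differs from 1 by at most \<open>norm x * norm \<xi>\<close>; this is where the first moment of the initial
  velocity enters.
\<close>

lemma fourier_diff_integral_le: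
  fixes f :: "real ^ 'n \<Rightarrow> complex"
  assumes f: "integrable lebesgue f" and f1: "integrable lebesgue (\<lambda>x. (1 + norm x) * norm (f x))"
  shows "norm (fourier f \<xi> - (LINT x|lebesgue. f x)) \<le> norm \<xi> * L11_norm f"
proof -
  let ?e = "\<lambda>x. exp (- (\<i> * complex_of_real (x \<bullet> \<xi>)))"
  have "fourier f \<xi> - (LINT x|lebesgue. f x) = (LINT x|lebesgue. ?e x * f x - f x)"
    unfolding fourier_def using f fourier_integrand_integrable[OF f] by simp
  also have "norm \<dots> \<le> (LINT x|lebesgue. norm (?e x * f x - f x))"
    by (rule integral_norm_bound)
  also have "\<dots> \<le> (LINT x|lebesgue. norm \<xi> * ((1 + norm x) * norm (f x)))"
  proof (rule integral_mono)
    show "integrable lebesgue (\<lambda>x. norm (?e x * f x - f x))"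
      by (intro integrable_norm Bochner_Integration.integrable_diff fourier_integrand_integrable f)
    show "integrable lebesgue (\<lambda>x. norm \<xi> * ((1 + norm x) * norm (f x)))"
      by (intro integrable_mult_right f1)
    fix x
    have "norm (?e x - 1) \<le> \<bar>x \<bullet> \<xi>\<bar>"
      using iexp_approx1[of "- (x \<bullet> \<xi>)" 0] by simp
    also have "\<dots> \<le> norm x * norm \<xi>" by (rule Cauchy_Schwarz_ineq2)
    also have "\<dots> \<le> norm \<xi> * (1 + norm x)" by (simp add: algebra_simps)
    finally have "norm (?e x - 1) * norm (f x) \<le> norm \<xi> * (1 + norm x) * norm (f x)"
      by (rule mult_right_mono) simp
    then show "norm (?e x * f x - f x) \<le> norm \<xi> * ((1 + norm x) * norm (f x))"
      by (simp add: norm_mult[symmetric] left_diff_distrib mult.assoc)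
  qed
  finally show ?thesis by (simp add: L11_norm_def)
qed

text \<open>
  The oscillation frequency is real and positive because \<open>ln (1 + r) < r\<close>. It behaves like \<open>r powr (3/2)\<close> near 0,
  so its reciprocal is not bounded by a multiple of 1/r; the estimates below use \<open>\<bar>sin (b t) / b\<bar> \<le> t\<close> instead.
\<close>

lemma frequency_pos:
  fixes r :: real
  assumes "r > 0"
  shows "0 < sqrt (r\<^sup>2 - (ln (1 + r))\<^sup>2)" and "(ln (1 + r))\<^sup>2 + (sqrt (r\<^sup>2 - (ln (1 + r))\<^sup>2))\<^sup>2 = r\<^sup>2"
proof -
  have "ln (1 + r) < r" "0 \<le> ln (1 + r)"
    using assms ln_add_one_self_less_self[of r] by auto
  then have "(ln (1 + r))\<^sup>2 < r\<^sup>2"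
    by (intro power_strict_mono) auto
  then show "0 < sqrt (r\<^sup>2 - (ln (1 + r))\<^sup>2)"
    and "(ln (1 + r))\<^sup>2 + (sqrt (r\<^sup>2 - (ln (1 + r))\<^sup>2))\<^sup>2 = r\<^sup>2"
    by auto
qed

lemma norm_profile_le:
  fixes \<xi> :: "real ^ 'n"
  assumes t: "t \<ge> 0"
  shows "norm (profile P t \<xi>) \<le> t * norm P * (1 + norm \<xi>) powr (- t)"
proof (cases "\<xi> = 0")
  case True
  then show ?thesis using t by (simp add: profile_def)
next
  case False
  define b where "b = sqrt ((norm \<xi>)\<^sup>2 - (ln (1 + norm \<xi>))\<^sup>2)"
  have b: "b > 0" using frequency_pos(1)[of "norm \<xi>"] False by (simp add: b_def)
  have "norm (profile P t \<xi>) = (1 + norm \<xi>) powr (- t) * \<bar>sin (b * t) / b\<bar> * norm P"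
    by (simp add: profile_def Let_def b_def norm_mult norm_divide abs_mult mult_ac)
  also have "\<dots> \<le> (1 + norm \<xi>) powr (- t) * t * norm P"
    by (intro mult_right_mono mult_left_mono abs_sin_divide_le b t) auto
  finally show ?thesis by (simp add: mult_ac)
qed

lemma profile_measurable: "profile P t \<in> borel_measurable (lebesgue :: (real^'n) measure)"
  unfolding profile_def Let_def by (intro borel_measurable_lebesgueI) measurable

text \<open>
  The profile is bounded by t times the damping factor. For square-integrability this is compared with the
  weight at time t. For integrability the damping factor is the square of the one at time \<open>t / 2\<close>; this is why
  t has to be twice as large as for the weight itself.
\<close>

lemma profile_L1_L2:
  assumes t: "t \<ge> 2 * real (CARD('n) + 1)"
  shows "integrable lebesgue (profile P t :: real ^ 'n \<Rightarrow> complex)"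
    and "in_L2 (profile P t :: real ^ 'n \<Rightarrow> complex)"
proof -
  have t0: "t \<ge> 0" using t by simp
  have W: "in_L2 (\<lambda>\<xi>::real^'n. complex_of_real (decay_weight t \<xi>))"
    "in_L2 (\<lambda>\<xi>::real^'n. complex_of_real (decay_weight (t / 2) \<xi>))"
    using t by (auto intro!: decay_weight_L2(1))
  have le: "(1 + norm \<xi>) powr (- s) \<le> decay_weight s \<xi>" if "s \<ge> 0" for s and \<xi> :: "real^'n"
    using mult_left_mono[of 1 "1 + s * norm \<xi>" "(1 + norm \<xi>) powr (- s)"] that
    by (simp add: decay_weight_def)
  show "in_L2 (profile P t :: real ^ 'n \<Rightarrow> complex)"
  proof (rule in_L2_AE_le[OF W(1) profile_measurable])
    have "norm (profile P t \<xi>) \<le> t * norm P * norm (complex_of_real (decay_weight t \<xi>))" for \<xi> :: "real^'n"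
      using norm_profile_le[OF t0, of P \<xi>] mult_left_mono[OF le[OF t0, of \<xi>], of "t * norm P"] t0
        decay_weight_nonneg[OF t0, of \<xi>]
      by simp
    then show "AE \<xi> in (lebesgue :: (real^'n) measure).
        norm (profile P t \<xi>) \<le> t * norm P * norm (complex_of_real (decay_weight t \<xi>))" by simp
  qed
  show "integrable lebesgue (profile P t :: real ^ 'n \<Rightarrow> complex)"
  proof (rule Bochner_Integration.integrable_bound[OF _ profile_measurable])
    show "integrable lebesgue (\<lambda>\<xi>::real^'n. t * norm P * (norm (complex_of_real (decay_weight (t / 2) \<xi>)))\<^sup>2)"
      by (intro integrable_mult_right in_L2_integrable W)
    have "norm (profile P t \<xi>) \<le> norm (t * norm P * (norm (complex_of_real (decay_weight (t / 2) \<xi>)))\<^sup>2)" for \<xi> :: "real^'n"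
    proof -
      have "(1 + norm \<xi>) powr (- t) = ((1 + norm \<xi>) powr (- (t / 2)))\<^sup>2"
        by (simp add: power2_eq_square powr_add[symmetric])
      also have "\<dots> \<le> (decay_weight (t / 2) \<xi>)\<^sup>2"
        using t0 by (intro power_mono le) auto
      finally have "t * norm P * (1 + norm \<xi>) powr (- t) \<le> t * norm P * (decay_weight (t / 2) \<xi>)\<^sup>2"
        using t0 by (intro mult_left_mono) auto
      then show ?thesis
        using norm_profile_le[OF t0, of P \<xi>] t0 by (simp add: abs_mult)
    qed
    then show "AE \<xi> in (lebesgue :: (real^'n) measure).
        norm (profile P t \<xi>) \<le> norm (t * norm P * (norm (complex_of_real (decay_weight (t / 2) \<xi>)))\<^sup>2)"
      by simp
  qed
qed

text \<open>
  Subtracting the profile from the explicit solution leaves three terms: the contribution of the initial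
  position through the cosine, the sine term with the initial velocity diminished by P, and the sine term
  with the damping constant, which is at most \<open>norm \<xi>\<close>. The last two carry the factor \<open>t * norm \<xi>\<close>.
\<close>

lemma mode_estimate:
  fixes w w' :: "real \<Rightarrow> complex" and \<xi> :: "real ^ 'n"
  assumes w: "\<And>t. t \<ge> 0 \<Longrightarrow> (w has_vector_derivative w' t) (at t within {0..})"
    and w': "\<And>t. t \<ge> 0 \<Longrightarrow> (w' has_vector_derivative
        - (of_real (2 * L_symbol \<xi>) * w' t) - of_real ((norm \<xi>)\<^sup>2) * w t) (at t within {0..})"
    and \<xi>: "\<xi> \<noteq> 0" and t: "t \<ge> 0"
    and M0: "norm (w 0) \<le> M0" and M1: "norm (w' 0 - P) \<le> norm \<xi> * M1"
  shows "norm (w t - profile P t \<xi>) \<le> (M1 + M0) * decay_weight t \<xi>"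
proof -
  define r where "r = norm \<xi>"
  define a where "a = ln (1 + r)"
  define b where "b = sqrt (r\<^sup>2 - a\<^sup>2)"
  have r: "r > 0" using \<xi> by (simp add: r_def)
  have b: "b > 0" and ab: "a\<^sup>2 + b\<^sup>2 = r\<^sup>2"
    using frequency_pos[OF r] by (simp_all add: a_def b_def)
  have a: "0 \<le> a" "a \<le> r"
    using r ln_add_one_self_le_self[of r] by (auto simp: a_def)
  have M0': "0 \<le> M0" using M0 norm_ge_zero order_trans by blast
  have "0 \<le> norm \<xi> * M1" using M1 norm_ge_zero order_trans by blast
  then have M1': "0 \<le> M1" using r by (simp add: r_def zero_le_mult_iff)
  define E where "E = (1 + r) powr (- t)"
  have E: "E = exp (- a * t)" "E \<ge> 0"
    using r by (simp_all add: E_def powr_def a_def mult.commute)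
  define S where "S = sin (b * t) / b"
  have S: "\<bar>S\<bar> \<le> t" unfolding S_def by (rule abs_sin_divide_le[OF b t])
  have "w t = of_real E * (of_real (cos (b * t)) * w 0 + of_real S * (w' 0 + of_real a * w 0))"
    unfolding E(1) S_def
  proof (rule damped_oscillator_solution[OF w _ _ t])
    show "(w' has_vector_derivative - (of_real (2 * a) * w' s) - of_real (a\<^sup>2 + b\<^sup>2) * w s) (at s within {0..})"
      if "s \<ge> 0" for s
      using w'[OF that] unfolding ab by (simp only: L_symbol_def a_def r_def)
  qed (use b in auto)
  moreover have "profile P t \<xi> = of_real E * (of_real S * P)"
    by (simp add: profile_def Let_def E_def S_def b_def a_def r_def mult_ac)
  ultimately have "w t - profile P t \<xi>
      = of_real E * (of_real (cos (b * t)) * w 0 + of_real S * (w' 0 - P) + of_real (S * a) * w 0)"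
    by (simp add: algebra_simps)
  also have "norm \<dots> \<le> E * (1 * M0 + t * (r * M1) + t * r * M0)"
    unfolding norm_mult[of "of_real E"] norm_of_real abs_of_nonneg[OF E(2)]
  proof (intro mult_left_mono E norm_triangle_mono)
    show "norm (of_real (cos (b * t)) * w 0) \<le> 1 * M0"
      unfolding norm_mult by (intro mult_mono M0) auto
    show "norm (of_real S * (w' 0 - P)) \<le> t * (r * M1)"
      unfolding norm_mult r_def using S t by (intro mult_mono M1) auto
    have "norm (complex_of_real (S * a)) \<le> t * r"
      unfolding norm_of_real abs_mult using S a t by (intro mult_mono) auto
    then show "norm (of_real (S * a) * w 0) \<le> t * r * M0"
      unfolding norm_mult[of _ "w 0"] using M0 t r by (intro mult_mono) auto
  qed
  also have "\<dots> \<le> (M1 + M0) * decay_weight t \<xi>"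
  proof -
    have "1 * M0 + t * (r * M1) + t * r * M0 \<le> (M1 + M0) * (1 + t * r)"
      using M1' by (simp add: algebra_simps)
    then have "E * (1 * M0 + t * (r * M1) + t * r * M0) \<le> E * ((M1 + M0) * (1 + t * r))"
      by (rule mult_left_mono) (rule E)
    then show ?thesis by (simp add: decay_weight_def E_def r_def mult_ac)
  qed
  finally show ?thesis .
qed

text \<open>
  The bound at each frequency, integrated over all frequencies and carried back to the space side by
  \<open>L2_norm_diff_inv_fourier_le\<close>.
\<close>

lemma mild_solution_asymptotics:
  fixes u0 u1 :: "real ^ 'n \<Rightarrow> complex"
  assumes u0: "in_H1 u0" "in_L1 u0" and u1: "in_L2 u1" "in_L11 u1" and sol: "mild_solution u0 u1 u"
    and t: "t \<ge> 2 * real (CARD('n) + 1)"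
  defines "P \<equiv> LINT y|lebesgue. u1 y"
  shows "in_L2 (\<lambda>x. u t x - inv_fourier (profile P t) x)"
    and "L2_norm (\<lambda>x. u t x - inv_fourier (profile P t) x)
      \<le> (L11_norm u1 + L1_norm u0) * (real (CARD('n) + 1) ^ (CARD('n) + 1) * sqrt ((pi / t) ^ CARD('n)))
        / sqrt ((2 * pi) ^ CARD('n))"
proof -
  let ?K = "L11_norm u1 + L1_norm u0"
  have t0: "t \<ge> 0" and tN: "t \<ge> real (CARD('n) + 1)" using t by simp_all
  have i0: "integrable lebesgue u0" "in_L2 u0" and i1: "integrable lebesgue u1"
    "integrable lebesgue (\<lambda>x. (1 + norm x) * norm (u1 x))"
    using u0 u1 by (simp_all add: in_L1_def in_H1_def in_L11_def)
  have K: "?K \<ge> 0"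
    by (simp add: L11_norm_def L1_norm_def add_nonneg_nonneg integral_nonneg)
  have ut: "in_L2 (u t)"
    using sol t0 by (simp add: mild_solution_def continuous_H1_def in_H1_def)
  note \<nu> = profile_L1_L2[OF t, of P]
  show "in_L2 (\<lambda>x. u t x - inv_fourier (profile P t) x)"
    by (intro in_L2_diff ut inv_fourier_L2(1) \<nu>)
  obtain w w' where ww: "\<And>t. t \<ge> 0 \<Longrightarrow> AE \<xi> in lebesgue. w t \<xi> = L2_fourier (u t) \<xi>"
    and ode: "AE \<xi> in lebesgue.
           w 0 \<xi> = L2_fourier u0 \<xi> \<and> w' 0 \<xi> = L2_fourier u1 \<xi> \<and>
           (\<forall>t\<ge>0.
              ((\<lambda>s. w s \<xi>) has_vector_derivative w' t \<xi>) (at t within {0..}) \<and>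
              ((\<lambda>s. w' s \<xi>) has_vector_derivative
                 - (of_real (2 * L_symbol \<xi>) * w' t \<xi>) - of_real ((norm \<xi>)\<^sup>2) * w t \<xi>)
                (at t within {0..}))"
    using sol unfolding mild_solution_def by blast
  have "AE \<xi> in (lebesgue :: (real^'n) measure). \<xi> \<notin> {0}"
    by (intro AE_not_in negligible_iff_null_sets[THEN iffD1]) simp
  then have "AE \<xi> in lebesgue. norm (L2_fourier (u t) \<xi> - profile P t \<xi>)
      \<le> norm (complex_of_real ?K * complex_of_real (decay_weight t \<xi>))"
    using ww[OF t0] ode L2_fourier_eq_fourier[OF i0] L2_fourier_eq_fourier[OF i1(1) u1(1)]
  proof eventually_elim
    case (elim \<xi>)
    have "norm (w t \<xi> - profile P t \<xi>) \<le> ?K * decay_weight t \<xi>"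
    proof (rule mode_estimate[where w = "\<lambda>s. w s \<xi>" and w' = "\<lambda>s. w' s \<xi>"])
      show "norm (w 0 \<xi>) \<le> L1_norm u0"
        using elim norm_fourier_le[of u0 \<xi>] by simp
      show "norm (w' 0 \<xi> - P) \<le> norm \<xi> * L11_norm u1"
        using elim fourier_diff_integral_le[OF i1, of \<xi>] by (simp add: P_def)
    qed (use elim t0 in auto)
    then show ?case
      using elim(2) K decay_weight_nonneg[OF t0, of \<xi>] by (simp add: norm_mult abs_mult del: of_real_add)
  qed
  then have "L2_norm (\<lambda>\<xi>. L2_fourier (u t) \<xi> - profile P t \<xi>)
      \<le> L2_norm (\<lambda>\<xi>::real^'n. complex_of_real ?K * complex_of_real (decay_weight t \<xi>))"
    by (intro L2_norm_AE_mono in_L2_diff in_L2_cmult L2_fourier_limit(1)[OF ut] \<nu> decay_weight_L2(1)[OF tN])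
  also have "\<dots> \<le> ?K * (real (CARD('n) + 1) ^ (CARD('n) + 1) * sqrt ((pi / t) ^ CARD('n)))"
    unfolding L2_norm_cmult norm_of_real abs_of_nonneg[OF K]
    by (intro mult_left_mono decay_weight_L2(2)[OF tN] K)
  finally have "L2_norm (\<lambda>\<xi>. L2_fourier (u t) \<xi> - profile P t \<xi>) / sqrt ((2 * pi) ^ CARD('n))
      \<le> ?K * (real (CARD('n) + 1) ^ (CARD('n) + 1) * sqrt ((pi / t) ^ CARD('n))) / sqrt ((2 * pi) ^ CARD('n))"
    by (rule divide_right_mono) simp
  with L2_norm_diff_inv_fourier_le[OF ut \<nu>]
  show "L2_norm (\<lambda>x. u t x - inv_fourier (profile P t) x)
      \<le> ?K * (real (CARD('n) + 1) ^ (CARD('n) + 1) * sqrt ((pi / t) ^ CARD('n))) / sqrt ((2 * pi) ^ CARD('n))"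
    by (rule order_trans)
qed

theorem theorem1p5:
  shows "\<exists>C>0. \<forall>(u0 :: real ^ 'n \<Rightarrow> complex) u1 u.
    in_H1 u0 \<longrightarrow> in_L1 u0 \<longrightarrow> in_L2 u1 \<longrightarrow> in_L11 u1 \<longrightarrow> mild_solution u0 u1 u \<longrightarrow>
    (\<forall>\<^sub>F t in at_top.
       in_L2 (\<lambda>x. u t x - inv_fourier (profile (LINT y|lebesgue. u1 y) t) x) \<and>
       L2_norm (\<lambda>x. u t x - inv_fourier (profile (LINT y|lebesgue. u1 y) t) x)
         \<le> C * (L11_norm u1 + L1_norm u0) * t powr (- (real CARD('n) / 2)))"
proof -
  let ?N = "CARD('n) + 1"
  define C where "C = real ?N ^ ?N * sqrt (pi ^ CARD('n)) / sqrt ((2 * pi) ^ CARD('n))"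
  have C: "C > 0" by (simp add: C_def)
  have rate: "sqrt ((pi / t) ^ CARD('n)) = sqrt (pi ^ CARD('n)) * t powr (- (real CARD('n) / 2))"
    if "t > 0" for t
  proof -
    have root: "sqrt (t ^ CARD('n)) = t powr (real CARD('n) / 2)"
      using that by (simp add: powr_realpow[symmetric] powr_half_sqrt[symmetric] powr_powr)
    have "sqrt ((pi / t) ^ CARD('n)) = sqrt (pi ^ CARD('n)) / sqrt (t ^ CARD('n))"
      by (simp only: power_divide real_sqrt_divide)
    then show ?thesis
      unfolding root powr_minus by (simp only: divide_inverse)
  qed
  show ?thesis
  proof (intro exI[of _ C] conjI C allI impI)
    fix u0 u1 :: "real ^ 'n \<Rightarrow> complex" and u
    assume H: "in_H1 u0" "in_L1 u0" "in_L2 u1" "in_L11 u1" "mild_solution u0 u1 u"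
    show "\<forall>\<^sub>F t in at_top.
       in_L2 (\<lambda>x. u t x - inv_fourier (profile (LINT y|lebesgue. u1 y) t) x) \<and>
       L2_norm (\<lambda>x. u t x - inv_fourier (profile (LINT y|lebesgue. u1 y) t) x)
         \<le> C * (L11_norm u1 + L1_norm u0) * t powr (- (real CARD('n) / 2))"
      using eventually_ge_at_top[of "2 * real ?N"]
    proof eventually_elim
      case (elim t)
      then have t0: "t > 0" by simp
      have const: "(L11_norm u1 + L1_norm u0) * (real ?N ^ ?N * sqrt ((pi / t) ^ CARD('n))) / sqrt ((2 * pi) ^ CARD('n))
          = C * (L11_norm u1 + L1_norm u0) * t powr (- (real CARD('n) / 2))"
        unfolding rate[OF t0] C_def by (simp only: divide_inverse mult_ac)
      show ?case
        using mild_solution_asymptotics[OF H elim] unfolding const by (rule conjI)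
    qed
  qed
qed

end
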